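(* Let $G=G_{2,f}$ be a Šunić group acting on the binary rooted tree that is non-torsion (i.e. contains an element of infinite order) and not isomorphic to the infinite dihedral group. Then $G$ is a primitive group; that is, for any maximal subgroup $M$ of infinite index in $G$, the (primitive) action of $G$ on the cosets of $M$ is faithful.
   Context: Let $X=\{\mathbf 0,\mathbf 1\}$ and let $T$ be the binary rooted tree with vertex set $X^*$ (finite words; $w$ is joined to $wx$ for $x\in X$). For $g\in\mathrm{Aut}\,T$ and a vertex $v$, $g_v\in \mathrm{Aut}\,T$ is the unique automorphism with $g(vw)=g(v)g_v(w)$ for all $w$; if $g$ fixes the first level $X$ pointwise, write $\psi(g)=(g_{\mathbf 0},g_{\mathbf 1})$. Šunić groups on the binary tree: let $f(x)=x^m+a_{m-1}x^{m-1}+\dots+a_1x+a_0\in\mathbb F_2[x]$ with $m\ge 1$, $a_0\neq 0$. Let $B\cong(\mathbb Z/2)^m$ be written multiplicatively with basis $b_0,\dots,b_{m-1}$; let $\rho\colon B\to B$ be the automorphism with $\rho(b_i)=b_{i+1}$ for $0\le i\le m-2$ and $\rho(b_{m-1})=b_0^{-a_0}b_1^{-a_1}\cdots b_{m-1}^{-a_{m-1}}$. Let $A=\langle a\rangle$ be of order 2 and $\omega\colon B\to A$ the homomorphism with $\omega(b_i)=1$ for $i\le m-2$ and $\omega(b_{m-1})=a$. Then $a$ acts on $T$ by swapping the first letter ($a(\mathbf 0w)=\mathbf 1w$, $a(\mathbf 1w)=\mathbf 0w$), and $x\in B$ acts recursively by fixing the first level with $\psi(x)=(\omega(x),\rho(x))$.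 These actions are faithful, and $G_{2,f}:=\langle A\cup B\rangle\le\mathrm{Aut}\,T$. Groups $G$ as in the claim do have maximal subgroups of infinite index (for instance $\langle (ab)^q,B\rangle$ for $q$ an odd prime, where $b\in B$ is the element with $\psi(b)=(a,b)$). *)

theory Defs
  imports
    "HOL-Algebra.Group_Action"
    "HOL-Algebra.Left_Coset"
    "HOL-Algebra.Generated_Groups"
    "HOL-Computational_Algebra.Polynomial"
    "HOL-Library.Z2"
begin

section \<open>The binary rooted tree and its automorphism group\<close>

text \<open>Vertices are finite words over the alphabet \<^typ>\<open>bool\<close>, where \<^term>\<open>False\<close> and
  \<^term>\<open>True\<close> stand for the letters 0 and 1; the root is the empty word.\<close>

type_synonym vertex = "bool list"

definition tree_adj :: "vertex \<Rightarrow> vertex \<Rightarrow> bool" where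
  "tree_adj u v \<longleftrightarrow> (\<exists>x. v = u @ [x] \<or> u = v @ [x])"

definition tree_Aut :: "(vertex \<Rightarrow> vertex) monoid" where
  "tree_Aut = \<lparr>carrier = {g. bij g \<and> g [] = [] \<and> (\<forall>u v. tree_adj (g u) (g v) \<longleftrightarrow> tree_adj u v)},
               monoid.mult = (\<circ>), one = id\<rparr>"

fun swap_first :: "vertex \<Rightarrow> vertex" where
  "swap_first [] = []"
| "swap_first (x # w) = (\<not> x) # w"


section \<open>Sunic groups on the binary tree\<close>

text \<open>The element \<open>\<Prod>i<m. b\<^sub>i ^ x i\<close> of \<open>B\<close> is represented by its exponent vector
  \<open>x :: nat \<Rightarrow> bit\<close>, supported on the indices below \<open>m = degree f\<close>; the product in \<open>B\<close> is therefore
  pointwise addition. Similarly, the element \<open>a\<^sup>e\<close> of \<open>A\<close> is represented by its exponent \<open>e :: bit\<close>.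
  The homomorphisms \<open>\<rho>\<close> and \<open>\<omega>\<close> are given by their values on the basis, extended linearly.
  The last two equations of \<open>act_B\<close> say that \<open>\<psi>(x) = (\<omega>(x), \<rho>(x))\<close>.\<close>

definition sunic_B :: "bit poly \<Rightarrow> (nat \<Rightarrow> bit) set" where
  "sunic_B f = {x. \<forall>i\<ge>degree f. x i = 0}"

definition sunic_b :: "nat \<Rightarrow> nat \<Rightarrow> bit" where
  "sunic_b i = (\<lambda>j. if j = i then 1 else 0)"

definition rho_basis :: "bit poly \<Rightarrow> nat \<Rightarrow> nat \<Rightarrow> bit" where
  "rho_basis f i =
     (if Suc i < degree f then sunic_b (Suc i)
      else (\<lambda>j. if j < degree f then - coeff f j else 0))"

definition sunic_rho :: "bit poly \<Rightarrow> (nat \<Rightarrow> bit) \<Rightarrow> nat \<Rightarrow> bit" where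
  "sunic_rho f x = (\<lambda>j. \<Sum>i<degree f. x i * rho_basis f i j)"

definition omega_basis :: "bit poly \<Rightarrow> nat \<Rightarrow> bit" where
  "omega_basis f i = (if Suc i < degree f then 0 else 1)"

definition sunic_omega :: "bit poly \<Rightarrow> (nat \<Rightarrow> bit) \<Rightarrow> bit" where
  "sunic_omega f x = (\<Sum>i<degree f. x i * omega_basis f i)"

definition act_A :: "bit \<Rightarrow> vertex \<Rightarrow> vertex" where
  "act_A e = (if e = 1 then swap_first else id)"

fun act_B :: "bit poly \<Rightarrow> (nat \<Rightarrow> bit) \<Rightarrow> vertex \<Rightarrow> vertex" where
  "act_B f x [] = []"
| "act_B f x (False # w) = False # act_A (sunic_omega f x) w"
| "act_B f x (True # w) = True # act_B f (sunic_rho f x) w"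

definition sunic_group :: "bit poly \<Rightarrow> (vertex \<Rightarrow> vertex) monoid" where
  "sunic_group f =
     tree_Aut\<lparr>carrier := generate tree_Aut (range act_A \<union> act_B f ` sunic_B f)\<rparr>"


section \<open>The infinite dihedral group\<close>

text \<open>The semidirect product of the integers with a group of order two acting by inversion;
  the pair \<open>(k, s)\<close> is translation by \<open>k\<close>, preceded by the reflection if \<open>s\<close> holds.\<close>

definition infinite_dihedral :: "(int \<times> bool) monoid" where
  "infinite_dihedral =
     \<lparr>carrier = UNIV,
      monoid.mult = (\<lambda>(k, s) (l, t). (k + (if s then - l else l), s \<noteq> t)),
      one = (0, False)\<rparr>"


section \<open>Maximal subgroups and primitive actions\<close>

definition torsion_group :: "('a, 'b) monoid_scheme \<Rightarrow> bool" where
  "torsion_group G \<longleftrightarrow> (\<forall>g\<in>carrier G. \<exists>n::nat. n > 0 \<and> g [^]\<^bsub>G\<^esub> n = \<one>\<^bsub>G\<^esub>)"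

definition maximal_subgroup :: "'a set \<Rightarrow> ('a, 'b) monoid_scheme \<Rightarrow> bool" where
  "maximal_subgroup M G \<longleftrightarrow>
     subgroup M G \<and> M \<noteq> carrier G \<and>
     (\<forall>H. subgroup H G \<and> M \<subseteq> H \<longrightarrow> H = M \<or> H = carrier G)"

definition infinite_index :: "'a set \<Rightarrow> ('a, 'b) monoid_scheme \<Rightarrow> bool" where
  "infinite_index M G \<longleftrightarrow> infinite (lcosets\<^bsub>G\<^esub> M)"

locale primitive_action = transitive_action +
  assumes primitive:
    "\<lbrakk>equiv E r; \<And>g x y. g \<in> carrier G \<Longrightarrow> (x, y) \<in> r \<Longrightarrow> (\<phi> g x, \<phi> g y) \<in> r\<rbrakk>
      \<Longrightarrow> r = Id_on E \<or> r = E \<times> E"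

definition coset_action ::
    "('a, 'b) monoid_scheme \<Rightarrow> 'a set \<Rightarrow> 'a \<Rightarrow> 'a set \<Rightarrow> 'a set" where
  "coset_action G M = (\<lambda>g. \<lambda>C\<in>lcosets\<^bsub>G\<^esub> M. g <#\<^bsub>G\<^esub> C)"

text \<open>A group is primitive if it has a faithful primitive action on some set. Quantifying over sets
  of type \<^typ>\<open>'a set set\<close> is no restriction: a transitive \<open>G\<close>-set is isomorphic to the set of left
  cosets of a point stabilizer.\<close>

definition primitive_group :: "('a, 'b) monoid_scheme \<Rightarrow> bool" where
  "primitive_group G \<longleftrightarrow>
     (\<exists>(E :: 'a set set) \<phi>. primitive_action G E \<phi> \<and> faithful_action G E \<phi>)"


section \<open>Basic facts\<close>

lemma swap_first_involution [simp]: "swap_first (swap_first w) = w"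
  by (cases w) auto

lemma range_act_A: "range act_A = {id, swap_first}"
  unfolding act_A_def by (auto simp: image_iff intro: exI[of _ "0::bit"] exI[of _ "1::bit"])

lemma sunic_b_in_B: "i < degree f \<Longrightarrow> sunic_b i \<in> sunic_B f"
  by (auto simp: sunic_b_def sunic_B_def)

lemma sunic_rho_in_B: "sunic_rho f x \<in> sunic_B f"
  by (auto simp: sunic_rho_def sunic_B_def rho_basis_def sunic_b_def intro!: sum.neutral)

lemma sunic_rho_b: "i < degree f \<Longrightarrow> sunic_rho f (sunic_b i) = rho_basis f i"
  by (rule ext) (simp add: sunic_rho_def sunic_b_def if_distrib if_distribR cong: if_cong)

lemma sunic_omega_b: "i < degree f \<Longrightarrow> sunic_omega f (sunic_b i) = omega_basis f i"
  by (simp add: sunic_omega_def sunic_b_def if_distrib if_distribR cong: if_cong)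

lemma sunic_rho_add: "sunic_rho f (\<lambda>i. x i + y i) = (\<lambda>j. sunic_rho f x j + sunic_rho f y j)"
  by (simp only: sunic_rho_def distrib_right sum.distrib)

lemma sunic_omega_add: "sunic_omega f (\<lambda>i. x i + y i) = sunic_omega f x + sunic_omega f y"
  by (simp only: sunic_omega_def distrib_right sum.distrib)

lemma tree_AutI:
  assumes inv: "\<And>w. g (g w) = w" and snoc: "\<And>w x. \<exists>y. g (w @ [x]) = g w @ [y]"
    and root: "g [] = []"
  shows "g \<in> carrier tree_Aut"
proof -
  have adj: "tree_adj (g u) (g v)" if "tree_adj u v" for u v
    using that snoc unfolding tree_adj_def by metis
  have "bij g"
    using inv by (metis bijI')
  moreover have "tree_adj (g u) (g v) \<longleftrightarrow> tree_adj u v" for u v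
    using adj[of u v] adj[of "g u" "g v"] inv by auto
  ultimately show ?thesis
    using root by (simp add: tree_Aut_def)
qed

lemma act_A_root [simp]: "act_A e [] = []"
  by (simp add: act_A_def)

lemma act_A_involution [simp]: "act_A e (act_A e w) = w"
  by (simp add: act_A_def)

lemma act_A_snoc: "\<exists>y. act_A e (w @ [x]) = act_A e w @ [y]"
  by (cases w) (auto simp: act_A_def)

lemma act_B_involution [simp]: "act_B f x (act_B f x w) = w"
  by (induction f x w rule: act_B.induct) auto

lemma act_B_snoc: "\<exists>y. act_B f x (w @ [z]) = act_B f x w @ [y]"
proof (induction f x w rule: act_B.induct)
  case (1 f x) show ?case by (cases z) auto
next
  case (2 f x w) show ?case using act_A_snoc by auto
next
  case (3 f x w) then show ?case by auto
qed

lemma act_A_in_Aut: "act_A e \<in> carrier tree_Aut"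
  by (rule tree_AutI) (auto intro: act_A_snoc)

lemma act_B_in_Aut: "act_B f x \<in> carrier tree_Aut"
  by (rule tree_AutI) (auto intro: act_B_snoc)

lemma group_tree_Aut: "group tree_Aut"
proof (rule groupI)
  fix g assume g: "g \<in> carrier tree_Aut"
  then have b: "bij g" by (simp add: tree_Aut_def)
  have "inv_into UNIV g \<in> carrier tree_Aut"
    using g b unfolding tree_Aut_def
    by (auto simp: bij_imp_bij_inv) (metis bij_inv_eq_iff)+
  moreover have "inv_into UNIV g \<circ> g = id"
    using b by (simp add: bij_is_inj)
  ultimately show "\<exists>h\<in>carrier tree_Aut. h \<otimes>\<^bsub>tree_Aut\<^esub> g = \<one>\<^bsub>tree_Aut\<^esub>"
    by (auto simp: tree_Aut_def)
qed (auto simp: tree_Aut_def bij_comp fun_eq_iff)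

lemma group_sunic_group: "group (sunic_group f)"
proof -
  interpret group tree_Aut by (rule group_tree_Aut)
  have "subgroup (generate tree_Aut (range act_A \<union> act_B f ` sunic_B f)) tree_Aut"
    by (rule generate_is_subgroup) (auto simp: act_A_in_Aut act_B_in_Aut)
  then show ?thesis
    unfolding sunic_group_def by (rule subgroup_imp_group)
qed

lemma group_infinite_dihedral: "group infinite_dihedral"
proof (rule groupI)
  fix p assume "p \<in> carrier infinite_dihedral"
  show "\<exists>q\<in>carrier infinite_dihedral. q \<otimes>\<^bsub>infinite_dihedral\<^esub> p = \<one>\<^bsub>infinite_dihedral\<^esub>"
    by (rule bexI[of _ "(if snd p then fst p else - fst p, snd p)"])
      (auto simp: infinite_dihedral_def split: prod.splits)
qed (auto simp: infinite_dihedral_def split: prod.splits)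

end

theory Submission
  imports Defs
begin

text \<open>Suppose \<open>m \<ge> 2\<close>. Let \<open>K\<close> be the normal closure of the squares \<open>(y a)\<^sup>2\<close>, where \<open>y\<close> ranges over
  \<open>\<rho>(ker \<omega>)\<close>. It has finite index, \<open>G\<close> is regular branch over it, and its derived subgroup \<open>D\<close> has
  finite index as well, because the elements \<open>y a\<close> have finite 2-power order. A normal subgroup that
  contains an element moving a vertex of level \<open>n\<close> contains a copy of \<open>D\<close> at every vertex of that
  level. Hence every nontrivial normal subgroup has finite index, and a maximal subgroup of infinite
  index has trivial core.

  As \<open>G\<close> is not a torsion group, there is an element \<open>b\<close> of \<open>B\<close> with \<open>\<psi>(b) = (a, b)\<close>. The subgroup
  generated by \<open>a b a b a\<close> and \<open>B\<close> is proper, since it does not act transitively on the \<open>G\<close>-orbit of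
  the end \<open>111\<dots>\<close>. A maximal subgroup \<open>M\<close> that contains it contains \<open>(a b)\<^sup>3\<close>; if \<open>M\<close> contained a
  nontrivial normal subgroup, it would also contain a power of \<open>a b\<close> with exponent a power of 2, hence
  \<open>a b\<close> and then all of \<open>G\<close>.\<close>

section \<open>Sections of tree automorphisms\<close>

text \<open>For \<open>m = 1\<close> the group is infinite dihedral, so the hypotheses leave
  \<open>m \<ge> 2\<close>; then \<open>\<rho>(ker \<omega>)\<close> has elements outside
  \<open>ker \<omega>\<close>, on which the branching rests.

  The obstacle to finite index of \<open>D\<close> is that \<open>a b\<close> may have infinite
  order. This shapes the choice of \<open>K\<close>: its normal generators have finite 2-power
  order, because the orbit of \<open>y\<close> under \<open>\<rho>\<close> meets
  \<open>ker \<omega>\<close>. They have infinitely many conjugates, but modulo \<open>D\<close> it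
  is enough to conjugate by representatives of the finitely many cosets of \<open>K\<close>.

  The copies at a vertex are copies of \<open>D\<close> and not of \<open>K\<close> because they are
  extracted from a normal subgroup by commutators.

  A claim about all maximal subgroups of infinite index could be vacuous, while
  \<open>primitive_group\<close> asks for an action to exist; therefore one suitable
  \<open>M\<close> is constructed. The word \<open>a b a b a\<close> comes from
  \<open>(a b)^3 b\<close>, and 3 serves as an odd number coprime to the powers of 2 that occur.

  The element \<open>b\<close> comes from an orbit of \<open>\<rho>\<close> that avoids
  \<open>ker \<omega>\<close>: without such an orbit every element would have finite order, and such
  an orbit consists of a single point.\<close>

definition pair :: "(vertex \<Rightarrow> vertex) \<Rightarrow> (vertex \<Rightarrow> vertex) \<Rightarrow> vertex \<Rightarrow> vertex" where
  "pair g h w = (case w of [] \<Rightarrow> [] | x # u \<Rightarrow> x # (if x then h u else g u))"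

lemma pair_simps [simp]:
  "pair g h [] = []"
  "pair g h (False # w) = False # g w"
  "pair g h (True # w) = True # h w"
  "pair g h (x # w) = x # (if x then h w else g w)"
  by (simp_all add: pair_def)

lemma fun_eq_vertexI:
  fixes F G :: "vertex \<Rightarrow> 'a"
  assumes "F [] = G []" "\<And>w. F (False # w) = G (False # w)" "\<And>w. F (True # w) = G (True # w)"
  shows "F = G"
proof
  fix w show "F w = G w"
    using assms by (induction w rule: act_B.induct) auto
qed

lemma pair_comp: "pair g h \<circ> pair g' h' = pair (g \<circ> g') (h \<circ> h')"
  by (rule fun_eq_vertexI) auto

lemma pair_id [simp]: "pair id id = id"
  by (rule fun_eq_vertexI) auto

lemma pair_funpow: "pair g h ^^ n = pair (g ^^ n) (h ^^ n)"
  by (induction n) (simp_all only: funpow.simps pair_comp pair_id)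

lemma swap_first_pair: "swap_first \<circ> pair g h = pair h g \<circ> swap_first"
  by (rule fun_eq_vertexI) auto

lemma swap_first_swap_first [simp]: "swap_first \<circ> swap_first = id"
  by auto

lemma act_A_simps [simp]: "act_A 0 = id" "act_A 1 = swap_first"
  by (simp_all add: act_A_def)

lemma act_A_add: "act_A d (act_A e w) = act_A (d + e) w"
  by (cases d; cases e) auto

lemma act_B_pair: "act_B f x = pair (act_A (sunic_omega f x)) (act_B f (sunic_rho f x))"
  by (rule fun_eq_vertexI) auto

lemma act_B_add: "act_B f x (act_B f y w) = act_B f (\<lambda>i. x i + y i) w"
proof (induction w arbitrary: x y)
  case (Cons z w)
  then show ?case
    by (cases z) (simp_all only: act_B.simps act_A_add sunic_rho_add sunic_omega_add)
qed simp

lemma act_B_act_B [simp]: "act_B f x \<circ> act_B f x = id"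
  by auto

lemma act_B_comp: "act_B f x \<circ> act_B f y = act_B f (\<lambda>i. x i + y i)"
  by (auto simp: act_B_add)

lemma act_B_commute: "act_B f x (act_B f y w) = act_B f y (act_B f x w)"
  unfolding act_B_add by (rule arg_cong[where f="\<lambda>z. act_B f z w"]) (rule ext, rule add.commute)

lemma act_B_zero [simp]: "act_B f (\<lambda>_. 0) = id"
proof -
  have "id = act_B f (\<lambda>_. 0) \<circ> act_B f (\<lambda>_. 0)"
    by (simp only: act_B_act_B)
  also have "\<dots> = act_B f (\<lambda>_. 0)"
    by (simp only: act_B_comp add_0_left)
  finally show ?thesis ..
qed

lemma sunic_B_add: "x \<in> sunic_B f \<Longrightarrow> y \<in> sunic_B f \<Longrightarrow> (\<lambda>i. x i + y i) \<in> sunic_B f"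
  by (simp add: sunic_B_def)

lemma sunic_B_zero: "(\<lambda>_. 0) \<in> sunic_B f"
  by (simp add: sunic_B_def)

lemma finite_sunic_B: "finite (sunic_B f)"
proof -
  have "inj_on (\<lambda>x. {i. x i = 1}) (sunic_B f)"
  proof (rule inj_onI)
    fix x y :: "nat \<Rightarrow> bit" assume "{i. x i = 1} = {i. y i = 1}"
    then have *: "x i = 1 \<longleftrightarrow> y i = 1" for i by blast
    have "x i = y i" for i
      using *[of i] by (cases "x i"; cases "y i") auto
    then show "x = y" by (rule ext)
  qed
  moreover have "(\<lambda>x. {i. x i = 1}) ` sunic_B f \<subseteq> Pow {..<degree f}"
  proof (rule image_subsetI)
    fix x assume "x \<in> sunic_B f"
    then have "x i = 1 \<Longrightarrow> i < degree f" for i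
      by (cases "i < degree f") (auto simp: sunic_B_def)
    then show "{i. x i = 1} \<in> Pow {..<degree f}" by auto
  qed
  ultimately show ?thesis
    by (metis finite_Pow_iff finite_lessThan inj_on_finite)
qed

section \<open>The elements of the group as products of generators\<close>

abbreviation invf :: "('a \<Rightarrow> 'a) \<Rightarrow> 'a \<Rightarrow> 'a" where
  "invf \<equiv> inv_into UNIV"

text \<open>The generators are involutions, so the products built by left multiplication are closed
  under inverses. Inductions over the group then have one case for \<open>a\<close> and one for
  \<open>B\<close>.\<close>

inductive_set sunic_elems :: "bit poly \<Rightarrow> (vertex \<Rightarrow> vertex) set" for f where
  id: "id \<in> sunic_elems f"
| swap: "g \<in> sunic_elems f \<Longrightarrow> swap_first \<circ> g \<in> sunic_elems f"
| act: "x \<in> sunic_B f \<Longrightarrow> g \<in> sunic_elems f \<Longrightarrow> act_B f x \<circ> g \<in> sunic_elems f"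

lemma swap_first_in: "swap_first \<in> sunic_elems f"
  using sunic_elems.swap[OF sunic_elems.id] by simp

lemma act_A_in: "act_A e \<in> sunic_elems f"
  by (cases e) (auto simp: swap_first_in sunic_elems.id)

lemma act_B_in: "x \<in> sunic_B f \<Longrightarrow> act_B f x \<in> sunic_elems f"
  using sunic_elems.act[OF _ sunic_elems.id] by simp

lemma sunic_elems_comp: "g \<in> sunic_elems f \<Longrightarrow> h \<in> sunic_elems f \<Longrightarrow> g \<circ> h \<in> sunic_elems f"
  by (induction rule: sunic_elems.induct) (auto simp: comp_assoc intro: sunic_elems.intros)

lemma involution_inv:
  assumes "s \<circ> s = id" shows "bij s" "invf s = s"
  using assms by (auto simp: o_bij inv_unique_comp)

lemma involution_comp_bij_inv:
  assumes "s \<circ> s = id" "s \<in> sunic_elems f" "bij g \<and> invf g \<in> sunic_elems f"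
  shows "bij (s \<circ> g) \<and> invf (s \<circ> g) \<in> sunic_elems f"
proof -
  have "invf (s \<circ> g) = invf g \<circ> s"
    using assms o_inv_distrib[of s g] involution_inv[OF assms(1)] by metis
  then show ?thesis
    using assms involution_inv[OF assms(1)] by (simp only: bij_comp sunic_elems_comp)
qed

lemma sunic_elems_bij_inv: "g \<in> sunic_elems f \<Longrightarrow> bij g \<and> invf g \<in> sunic_elems f"
proof (induction rule: sunic_elems.induct)
  case id then show ?case using sunic_elems.id by (simp only: bij_id inv_id)
next
  case (swap g)
  show ?case
    by (rule involution_comp_bij_inv[OF swap_first_swap_first swap_first_in swap.IH])
next
  case (act x g)
  show ?case
    by (rule involution_comp_bij_inv[OF act_B_act_B act_B_in[OF act.hyps(1)] act.IH])
qed

lemmas sunic_elems_bij = sunic_elems_bij_inv[THEN conjunct1]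
lemmas sunic_elems_inv = sunic_elems_bij_inv[THEN conjunct2]

lemma inv_apply:
  assumes "g \<in> sunic_elems f"
  shows "invf g (g w) = w" "g (invf g w) = w"
  using sunic_elems_bij[OF assms] by (simp_all add: bij_is_inj bij_is_surj surj_f_inv_f)

lemma inv_comp:
  assumes "g \<in> sunic_elems f" "h \<in> sunic_elems f"
  shows "invf (g \<circ> h) = invf h \<circ> invf g"
  using assms sunic_elems_bij by (blast intro: o_inv_distrib)

lemma inv_inv:
  assumes "g \<in> sunic_elems f" shows "invf (invf g) = g"
  using assms sunic_elems_bij inv_inv_eq by blast

lemma inv_swap_first [simp]: "invf swap_first = swap_first"
  by (rule involution_inv) simp

lemma inv_act_B [simp]: "invf (act_B f x) = act_B f x"
  by (rule involution_inv) simp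

lemma inv_eqI: "g \<circ> h = id \<Longrightarrow> h \<circ> g = id \<Longrightarrow> invf g = h"
  by (rule inv_unique_comp)

lemma inv_pair:
  assumes "g \<in> sunic_elems f" "h \<in> sunic_elems f"
  shows "invf (pair g h) = pair (invf g) (invf h)"
  using assms by (intro inv_eqI) (auto simp: pair_comp inv_apply[OF assms(1)] inv_apply[OF assms(2)] intro!: fun_eq_vertexI)

lemma mult_sunic [simp]: "g \<otimes>\<^bsub>sunic_group f\<^esub> h = g \<circ> h"
  and one_sunic [simp]: "\<one>\<^bsub>sunic_group f\<^esub> = id"
  by (simp_all add: sunic_group_def tree_Aut_def)

lemma carrier_sunic [simp]: "carrier (sunic_group f) = sunic_elems f"
proof -
  interpret T: group tree_Aut by (rule group_tree_Aut)
  let ?S = "range act_A \<union> act_B f ` sunic_B f"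
  have mult_eq: "g \<otimes>\<^bsub>tree_Aut\<^esub> h = g \<circ> h" for g h by (simp add: tree_Aut_def)
  have one_eq: "\<one>\<^bsub>tree_Aut\<^esub> = id" by (simp add: tree_Aut_def)
  have inv_eq: "inv\<^bsub>tree_Aut\<^esub> s = s" if "s \<in> ?S" for s
    using that act_A_in_Aut act_B_in_Aut
    by (intro T.inv_equality) (auto simp: mult_eq one_eq)
  have S: "s \<in> sunic_elems f" if "s \<in> ?S" for s
    using that act_A_in act_B_in by blast
  have "g \<in> sunic_elems f" if "g \<in> generate tree_Aut ?S" for g
    using that
  proof (induction rule: generate.induct)
    case one then show ?case using sunic_elems.id by (simp only: one_eq)
  next
    case (eng h1 h2) then show ?case using sunic_elems_comp by (simp only: mult_eq)
  qed (use S inv_eq in \<open>simp_all only:\<close>)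
  moreover have "g \<in> generate tree_Aut ?S" if "g \<in> sunic_elems f" for g
    using that
  proof (induction rule: sunic_elems.induct)
    case id then show ?case using generate.one[of tree_Aut] by (simp only: one_eq)
  next
    case (swap g)
    have "swap_first \<in> ?S" by (auto simp: range_act_A)
    from generate.eng[OF generate.incl[OF this] swap.IH] show ?case by (simp only: mult_eq)
  next
    case (act x g)
    from act(1) have "act_B f x \<in> ?S" by auto
    from generate.eng[OF generate.incl[OF this] act.IH] show ?case by (simp only: mult_eq)
  qed
  ultimately show ?thesis by (auto simp: sunic_group_def)
qed

lemma m_inv_sunic [simp]:
  assumes "g \<in> sunic_elems f" shows "inv\<^bsub>sunic_group f\<^esub> g = invf g"
proof -
  interpret group "sunic_group f" by (rule group_sunic_group)
  show ?thesis
    using assms by (intro inv_equality) (auto simp: sunic_elems_inv inv_apply[OF assms])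
qed

lemma pow_sunic [simp]: "g [^]\<^bsub>sunic_group f\<^esub> (n::nat) = g ^^ n"
proof -
  interpret group "sunic_group f" by (rule group_sunic_group)
  show ?thesis
    by (induction n) (simp_all only: nat_pow_0 nat_pow_Suc one_sunic mult_sunic funpow.simps(1) funpow_Suc_right)
qed

lemma sunic_elems_take:
  "g \<in> sunic_elems f \<Longrightarrow> length (g w) = length w \<and> take n (g w) = g (take n w)"
proof (induction arbitrary: w n rule: sunic_elems.induct)
  case id then show ?case by simp
next
  have sw: "length (swap_first w) = length w \<and> take n (swap_first w) = swap_first (take n w)" for w n
    by (cases w; cases n) auto
  case (swap g)
  then show ?case by (simp add: sw)
next
  have swap: "length (act_A e w) = length w \<and> take n (act_A e w) = act_A e (take n w)" for e w n
    by (cases e; cases w; cases n) auto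
  case (act x g)
  have "length (act_B f x w) = length w \<and> take n (act_B f x w) = act_B f x (take n w)" for x w n
  proof (induction w arbitrary: x n)
    case (Cons z w)
    then show ?case
      using swap by (cases n; cases z) auto
  qed simp
  then show ?case using act by simp
qed

lemma normal_sunicD:
  assumes "N \<lhd> sunic_group f"
  shows "N \<subseteq> sunic_elems f" "id \<in> N"
    and "g \<in> N \<Longrightarrow> h \<in> N \<Longrightarrow> g \<circ> h \<in> N"
    and "g \<in> N \<Longrightarrow> invf g \<in> N"
    and "g \<in> N \<Longrightarrow> h \<in> sunic_elems f \<Longrightarrow> h \<circ> g \<circ> invf h \<in> N"
proof -
  interpret normal N "sunic_group f" by fact
  show sub: "N \<subseteq> sunic_elems f" using subset by simp
  show "id \<in> N" using subgroup.one_closed[OF subgroup_axioms] unfolding one_sunic .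
  show "g \<in> N \<Longrightarrow> h \<in> N \<Longrightarrow> g \<circ> h \<in> N" using subgroup.m_closed[OF subgroup_axioms] by simp
  show "invf g \<in> N" if "g \<in> N"
    using subgroup.m_inv_closed[OF subgroup_axioms that] m_inv_sunic[of g f] that sub by (metis subsetD)
  show "g \<in> N \<Longrightarrow> h \<in> sunic_elems f \<Longrightarrow> h \<circ> g \<circ> invf h \<in> N"
    using inv_op_closed2[of h g] m_inv_sunic[of h f] by (metis carrier_sunic mult_sunic)
qed

lemma normal_sunicI:
  assumes "N \<subseteq> sunic_elems f" "id \<in> N"
    and "\<And>g h. g \<in> N \<Longrightarrow> h \<in> N \<Longrightarrow> g \<circ> h \<in> N"
    and "\<And>g. g \<in> N \<Longrightarrow> invf g \<in> N"
    and "\<And>g h. g \<in> N \<Longrightarrow> h \<in> sunic_elems f \<Longrightarrow> h \<circ> g \<circ> invf h \<in> N"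
  shows "N \<lhd> sunic_group f"
proof -
  interpret group "sunic_group f" by (rule group_sunic_group)
  have "subgroup N (sunic_group f)"
    using assms by (intro subgroupI) auto
  then show ?thesis
    using assms by (intro normal_invI) auto
qed

lemma funpow_conj:
  assumes "h' \<circ> h = id" "h \<circ> h' = id"
  shows "(h \<circ> g \<circ> h') ^^ n = h \<circ> g ^^ n \<circ> h'"
proof (induction n)
  case (Suc n)
  have "(h \<circ> g \<circ> h') ^^ Suc n = h \<circ> g \<circ> (h' \<circ> h) \<circ> g ^^ n \<circ> h'"
    unfolding funpow.simps Suc by (simp only: comp_assoc)
  then show ?case
    by (simp only: assms funpow.simps comp_assoc id_comp comp_id)
qed (simp add: assms)

lemma funpow_power2_Suc: "g ^^ (2 ^ Suc k) = (g \<circ> g) ^^ (2 ^ k)"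
proof -
  have "g ^^ 2 = g \<circ> g" by (simp only: numeral_2_eq_2 funpow.simps comp_id)
  then show ?thesis using funpow_mult[where m = 2 and n = "2 ^ k" and f = g] by (simp add: mult.commute)
qed

lemma bit_cases: "(b::bit) = 0 \<or> b = 1"
  by (cases b) auto

section \<open>The linear map \<open>\<rho>\<close> on \<open>B\<close> and the orders of the
  elements \<open>a y\<close>\<close>

locale sunic =
  fixes f :: "bit poly"
  assumes deg: "degree f \<ge> 1" and coeff0: "coeff f 0 \<noteq> 0"
begin

abbreviation "m \<equiv> degree f"
abbreviation "G \<equiv> sunic_elems f"
abbreviation "B \<equiv> sunic_B f"
abbreviation "\<rho> \<equiv> sunic_rho f"
abbreviation "\<omega> \<equiv> sunic_omega f"
abbreviation "\<beta> \<equiv> act_B f"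

abbreviation "swp \<equiv> swap_first"

text \<open>If \<open>b_i\<close> is identified with the class of \<open>x^i\<close>, then
  \<open>\<rho>\<close> is multiplication by \<open>x\<close> modulo \<open>f\<close>: a shift of
  the coordinates, with the top one fed back through the coefficients. Signs disappear over the
  field with two elements.\<close>

lemma rho_apply:
  "\<rho> x j = (if j < m then (if j = 0 then 0 else x (j - 1)) + x (m - 1) * coeff f j else 0)"
proof -
  obtain n where n: "m = Suc n" using deg by (cases m) auto
  have "\<rho> x j = (\<Sum>i<n. x i * rho_basis f i j) + x n * rho_basis f n j"
    by (simp add: sunic_rho_def n)
  also have "(\<Sum>i<n. x i * rho_basis f i j) = (\<Sum>i<n. if Suc i = j then x i else 0)"
    by (intro sum.cong) (auto simp: rho_basis_def sunic_b_def n)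
  also have "\<dots> = (if 0 < j \<and> j \<le> n then x (j - 1) else 0)"
    by (cases j) (auto simp: less_eq_Suc_le)
  finally show ?thesis
    by (auto simp: rho_basis_def n)
qed

lemma omega_apply: "\<omega> x = x (m - 1)"
proof -
  obtain n where n: "m = Suc n" using deg by (cases m) auto
  have "(\<Sum>i<n. x i * omega_basis f i) = 0"
    by (intro sum.neutral) (auto simp: omega_basis_def n)
  then show ?thesis
    by (simp add: sunic_omega_def n omega_basis_def)
qed

text \<open>The constant coefficient is 1, so coordinate 0 of \<open>\<rho> x\<close> is the top
  coordinate of \<open>x\<close>. Once the feedback is known, the shift can be undone.\<close>

lemma rho_inj: "inj_on \<rho> B"
proof (rule inj_onI)
  fix x y assume B: "x \<in> B" "y \<in> B" and eq: "\<rho> x = \<rho> y"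
  have c: "coeff f 0 = 1" using coeff0 by (simp add: bit_not_zero_iff)
  have last: "x (m - 1) = y (m - 1)"
    using fun_cong[OF eq, of 0] deg c unfolding rho_apply by (auto simp only: if_True mult_1_right add_0_left simp_thms order_less_le_trans[OF zero_less_one])
  have "x i = y i" for i
  proof (cases "Suc i < m")
    case True
    then show ?thesis
      using fun_cong[OF eq, of "Suc i"] last unfolding rho_apply
      by (simp only: if_True if_False nat.distinct diff_Suc_1 add_right_cancel)
  next
    case False
    then have "i = m - 1 \<or> i \<ge> m" by linarith
    then show ?thesis using last B by (auto simp: sunic_B_def)
  qed
  then show "x = y" by (rule ext)
qed

lemma rho_image: "\<rho> ` B = B"
  by (rule endo_inj_surj[OF finite_sunic_B _ rho_inj]) (auto simp: sunic_rho_in_B)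

lemma rho_pow_in: "x \<in> B \<Longrightarrow> (\<rho> ^^ n) x \<in> B"
  by (induction n) (auto simp: sunic_rho_in_B)

text \<open>\<open>B\<close> is finite and \<open>\<rho>\<close> is injective on it, so a repetition
  in the orbit can be cancelled back to the starting point.\<close>

lemma rho_periodic:
  assumes "x \<in> B"
  obtains n where "(\<rho> ^^ Suc n) x = x"
proof -
  have "finite (range (\<lambda>n. (\<rho> ^^ n) x))"
    by (rule finite_subset[OF _ finite_sunic_B[of f]]) (auto simp: rho_pow_in[OF assms])
  then have "\<not> inj (\<lambda>n. (\<rho> ^^ n) x)"
    using finite_imageD infinite_UNIV_nat by blast
  then obtain i j where "i < j" and ij: "(\<rho> ^^ i) x = (\<rho> ^^ j) x"
    unfolding inj_def by (metis linorder_neqE_nat)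
  then obtain n where j: "j = i + Suc n"
    by (metis add_Suc_right less_iff_Suc_add)
  have "(\<rho> ^^ i) y = (\<rho> ^^ i) z \<Longrightarrow> y = z" if "y \<in> B" "z \<in> B" for y z
    using that
  proof (induction i)
    case (Suc i)
    then show ?case using inj_onD[OF rho_inj] rho_pow_in by simp
  qed simp
  moreover have "(\<rho> ^^ i) x = (\<rho> ^^ i) ((\<rho> ^^ Suc n) x)"
    using ij unfolding j funpow_add comp_apply .
  ultimately have "(\<rho> ^^ Suc n) x = x"
    using rho_pow_in[OF assms] assms by metis
  then show ?thesis by (rule that)
qed

text \<open>Iterating \<open>\<rho>\<close> shifts lower coordinates into the top position, where
  \<open>\<omega>\<close> reads them. The coordinates vanish from the top down, since a zero top
  coordinate produces no feedback.\<close>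

lemma omega_rho_faithful:
  assumes "x \<in> B" "\<And>j. \<omega> ((\<rho> ^^ j) x) = 0"
  shows "x = (\<lambda>_. 0)"
proof -
  have "x i = 0" if "m - n \<le> i" for i n
    using assms that
  proof (induction n arbitrary: x i)
    case 0
    then show ?case by (simp add: sunic_B_def)
  next
    case (Suc n)
    have last: "x (m - 1) = 0" using Suc.prems(2)[of 0] by (simp add: omega_apply)
    have "\<rho> x (Suc i) = 0"
    proof (rule Suc.IH)
      show "\<omega> ((\<rho> ^^ j) (\<rho> x)) = 0" for j
        using Suc.prems(2)[of "Suc j"] by (simp add: funpow_swap1)
    qed (use Suc.prems in \<open>auto simp: sunic_rho_in_B\<close>)
    then have "x i = 0" if "Suc i < m"
      using that last by (simp add: rho_apply)
    moreover have "Suc i < m \<or> i = m - 1 \<or> i \<ge> m" by linarith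
    ultimately show ?case using last Suc.prems(1) by (auto simp: sunic_B_def)
  qed
  from this[of m] show ?thesis by auto
qed

definition B2 :: "(nat \<Rightarrow> bit) set" where
  "B2 = {y \<in> B. y 0 = 0}"

text \<open>\<open>B2\<close> is the image of the kernel of \<open>\<omega>\<close> under \<open>\<rho>\<close>.\<close>

lemma B2_preimage:
  assumes "y \<in> B2"
  obtains x where "x \<in> B" "\<omega> x = 0" "\<rho> x = y"
proof
  let ?x = "\<lambda>i. y (Suc i)"
  show "?x \<in> B" using assms by (auto simp: B2_def sunic_B_def)
  show "\<omega> ?x = 0" using assms deg by (auto simp: B2_def omega_apply sunic_B_def)
  show "\<rho> ?x = y"
    using assms deg by (auto simp: rho_apply fun_eq_iff B2_def sunic_B_def)
qed

lemma B2_subset: "y \<in> B2 \<Longrightarrow> y \<in> B"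
  by (simp add: B2_def)

text \<open>The preimage of \<open>y\<close> in the kernel lies on the same finite cycle of
  \<open>\<rho>\<close>, so the orbit of \<open>y\<close> returns to it.\<close>

lemma B2_hits_kernel:
  assumes "y \<in> B2"
  shows "\<exists>j. \<omega> ((\<rho> ^^ j) y) = 0"
proof -
  obtain x where x: "x \<in> B" "\<omega> x = 0" "\<rho> x = y" using B2_preimage[OF assms] .
  obtain n where "(\<rho> ^^ Suc n) x = x" using rho_periodic[OF x(1)] .
  then have "(\<rho> ^^ n) y = x" using x by (simp add: funpow_swap1)
  then show ?thesis using x by blast
qed

lemma act_B_kernel: "\<omega> x = 0 \<Longrightarrow> \<beta> x = pair id (\<beta> (\<rho> x))"
  by (subst act_B_pair) (simp only: act_A_simps)

lemma act_B_nonkernel: "\<omega> x = 1 \<Longrightarrow> \<beta> x = pair swp (\<beta> (\<rho> x))"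
  by (subst act_B_pair) (simp only: act_A_simps)

lemma swap_conj_pair: "swp \<circ> pair g h \<circ> swp = pair h g"
  by (simp only: swap_first_pair comp_assoc swap_first_swap_first comp_id)

text \<open>If \<open>y\<close> is in the kernel, both sections of \<open>(a y)^2\<close> are the
  involution \<open>\<rho> y\<close>, and \<open>(a y)^4 = 1\<close>. Otherwise they are
  \<open>(\<rho> y) a\<close> and \<open>a (\<rho> y)\<close>, which are conjugate by
  \<open>a\<close>. So each step along the orbit before the kernel costs one squaring.\<close>

lemma swap_act_torsion:
  assumes "\<omega> ((\<rho> ^^ j) y) = 0"
  shows "\<exists>k. (swp \<circ> \<beta> y) ^^ (2 ^ k) = id"
  using assms
proof (induction j arbitrary: y)
  have base: "\<exists>k. (swp \<circ> \<beta> y) ^^ (2 ^ k) = id" if "\<omega> y = 0" for y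
  proof -
    have "swp \<circ> \<beta> y \<circ> (swp \<circ> \<beta> y) = (swp \<circ> \<beta> y \<circ> swp) \<circ> \<beta> y"
      by (simp only: comp_assoc)
    also have "\<dots> = pair (\<beta> (\<rho> y)) (\<beta> (\<rho> y))"
      by (simp only: act_B_kernel[OF that] swap_conj_pair pair_comp id_comp comp_id)
    finally have "(swp \<circ> \<beta> y) ^^ (2 ^ Suc (Suc 0)) = id"
      by (simp only: funpow_power2_Suc pair_comp act_B_act_B pair_id id_funpow)
    then show ?thesis ..
  qed
  {
    case 0 then show ?case using base[of y] by (simp only: funpow_0)
  next
    case (Suc j)
    show ?case
    proof (cases "\<omega> y = 0")
      case False
      then have y: "\<omega> y = 1" by (simp add: bit_not_zero_iff)
      have "\<omega> ((\<rho> ^^ j) (\<rho> y)) = 0"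
        using Suc.prems by (simp add: funpow_swap1)
      then obtain k where k: "(swp \<circ> \<beta> (\<rho> y)) ^^ (2 ^ k) = id"
        using Suc.IH by blast
      have "swp \<circ> \<beta> y \<circ> (swp \<circ> \<beta> y) = (swp \<circ> \<beta> y \<circ> swp) \<circ> \<beta> y"
        by (simp only: comp_assoc)
      also have "\<dots> = pair (\<beta> (\<rho> y) \<circ> swp) (swp \<circ> \<beta> (\<rho> y))"
        by (simp only: act_B_nonkernel[OF y] swap_conj_pair pair_comp)
      finally have 1: "swp \<circ> \<beta> y \<circ> (swp \<circ> \<beta> y) = pair (\<beta> (\<rho> y) \<circ> swp) (swp \<circ> \<beta> (\<rho> y))" .
      have "\<beta> (\<rho> y) \<circ> swp = swp \<circ> (swp \<circ> \<beta> (\<rho> y)) \<circ> swp"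
        by (simp only: comp_assoc[symmetric] swap_first_swap_first id_comp)
      then have "(\<beta> (\<rho> y) \<circ> swp) ^^ (2 ^ k) = id"
        by (simp only: funpow_conj[OF swap_first_swap_first swap_first_swap_first] k comp_id
            swap_first_swap_first)
      then have "(swp \<circ> \<beta> y) ^^ (2 ^ Suc k) = id"
        by (simp only: funpow_power2_Suc 1 pair_funpow k pair_id)
      then show ?thesis ..
    qed (rule base)
  }
qed

end

section \<open>A normal subgroup over which the group is regular branch\<close>

context sunic
begin

text \<open>This is \<open>(y a)^2\<close>, and also the commutator of \<open>y\<close> and
  \<open>a\<close>, both being involutions. Dividing by all of these makes \<open>B2\<close>
  central.\<close>

definition r :: "(nat \<Rightarrow> bit) \<Rightarrow> vertex \<Rightarrow> vertex" where
  "r y = \<beta> y \<circ> swp \<circ> \<beta> y \<circ> swp"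

lemma r_in: "y \<in> B2 \<Longrightarrow> r y \<in> G"
  unfolding r_def by (intro sunic_elems_comp act_B_in swap_first_in B2_subset)

text \<open>Conjugation by \<open>a\<close> turns \<open>r y\<close> into \<open>(a y)^2\<close>,
  and the orbit of \<open>y\<close> meets the kernel because \<open>y\<close> lies in
  \<open>B2\<close>.\<close>

lemma r_torsion:
  assumes "y \<in> B2"
  shows "\<exists>k. r y ^^ (2 ^ k) = id"
proof -
  obtain k where k: "(swp \<circ> \<beta> y) ^^ (2 ^ k) = id"
    using B2_hits_kernel[OF assms] swap_act_torsion by blast
  have "(swp \<circ> \<beta> y) ^^ (2 ^ Suc k) = id"
    using k by (simp add: funpow_add mult_2 del: comp_apply)
  then have "(swp \<circ> \<beta> y \<circ> (swp \<circ> \<beta> y)) ^^ (2 ^ k) = id"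
    by (simp only: funpow_power2_Suc)
  moreover have "r y = swp \<circ> (swp \<circ> \<beta> y \<circ> (swp \<circ> \<beta> y)) \<circ> swp"
    by (simp add: r_def fun_eq_iff)
  ultimately have "r y ^^ (2 ^ k) = id"
    by (simp only: funpow_conj[OF swap_first_swap_first swap_first_swap_first] comp_id
        swap_first_swap_first)
  then show ?thesis ..
qed

text \<open>The normal closure of the elements \<open>r y\<close>. Inverses are covered by the
  conjugates, since the inverse of \<open>r y\<close> is its conjugate by \<open>a\<close>.\<close>

inductive_set K :: "(vertex \<Rightarrow> vertex) set" where
  id: "id \<in> K"
| conj: "g \<in> G \<Longrightarrow> y \<in> B2 \<Longrightarrow> k \<in> K \<Longrightarrow> g \<circ> r y \<circ> invf g \<circ> k \<in> K"

lemma K_gen: "g \<in> G \<Longrightarrow> y \<in> B2 \<Longrightarrow> g \<circ> r y \<circ> invf g \<in> K"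
  using K.conj[OF _ _ K.id] by (simp only: comp_id)

lemma r_in_K: "y \<in> B2 \<Longrightarrow> r y \<in> K"
  using K_gen[OF sunic_elems.id] by (simp only: comp_id id_comp inv_id)

lemma swap_r_in_K: "y \<in> B2 \<Longrightarrow> swp \<circ> \<beta> y \<circ> swp \<circ> \<beta> y \<in> K"
proof -
  assume "y \<in> B2"
  from K_gen[OF swap_first_in this] show ?thesis
    by (simp only: r_def inv_swap_first comp_assoc swap_first_swap_first comp_id)
qed

lemma K_subset: "k \<in> K \<Longrightarrow> k \<in> G"
  by (induction rule: K.induct) (blast intro: sunic_elems.id sunic_elems_comp sunic_elems_inv r_in)+

lemma K_comp: "k \<in> K \<Longrightarrow> k' \<in> K \<Longrightarrow> k \<circ> k' \<in> K"
proof (induction rule: K.induct)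
  case (conj g y k)
  from K.conj[OF conj(1,2) conj(4)[OF conj(5)]] show ?case by (simp only: comp_assoc)
qed simp

lemma K_conj: "k \<in> K \<Longrightarrow> h \<in> G \<Longrightarrow> h \<circ> k \<circ> invf h \<in> K"
proof (induction rule: K.induct)
  case id
  then have "h \<circ> id \<circ> invf h = id" by (simp add: inv_apply[OF id] fun_eq_iff)
  then show ?case using K.id by (simp only:)
next
  case (conj g y k)
  have "h \<circ> (g \<circ> r y \<circ> invf g \<circ> k) \<circ> invf h = (h \<circ> g) \<circ> r y \<circ> invf (h \<circ> g) \<circ> (h \<circ> k \<circ> invf h)"
    by (simp add: inv_comp[OF conj(5,1)] fun_eq_iff inv_apply[OF conj(5)])
  then show ?case
    using K.conj[OF sunic_elems_comp[OF conj(5,1)] conj(2) conj(4)[OF conj(5)]] by (simp only:)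
qed

lemma K_inv: "k \<in> K \<Longrightarrow> invf k \<in> K"
proof (induction rule: K.induct)
  case id show ?case using K.id by (simp only: inv_id)
next
  case (conj g y k)
  have gs: "g \<circ> swp \<in> G" using conj by (intro sunic_elems_comp swap_first_in)
  have "invf (g \<circ> r y \<circ> invf g \<circ> k) = invf k \<circ> (g \<circ> swp \<circ> r y \<circ> invf (g \<circ> swp))"
  proof (rule inv_eqI)
  qed (auto simp: inv_comp[OF conj(1) swap_first_in] fun_eq_iff inv_apply[OF conj(1)] r_def
      inv_apply[OF K_subset[OF conj(3)]])
  then show ?case
    using K_comp[OF conj(4) K_gen[OF gs conj(2)]] by (simp only:)
qed

lemma K_normal: "K \<lhd> sunic_group f"
  by (rule normal_sunicI) (use K.id K_subset K_comp K_inv K_conj in blast)+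

end

text \<open>Self-similarity: an element of \<open>B\<close> moves past the swap by exchanging its
  two sections, so the swap can be collected on the left.\<close>

lemma sunic_elems_pair:
  "g \<in> sunic_elems f \<Longrightarrow> \<exists>g0\<in>sunic_elems f. \<exists>g1\<in>sunic_elems f. g = pair g0 g1 \<or> g = swap_first \<circ> pair g0 g1"
proof (induction rule: sunic_elems.induct)
  case id
  have "id = pair id id" by (simp only: pair_id)
  then show ?case using sunic_elems.id by blast
next
  case (swap g)
  then obtain g0 g1 where g: "g0 \<in> sunic_elems f" "g1 \<in> sunic_elems f"
    "g = pair g0 g1 \<or> g = swap_first \<circ> pair g0 g1" by blast
  have "swap_first \<circ> (swap_first \<circ> pair g0 g1) = pair g0 g1"
    by (simp only: comp_assoc[symmetric] swap_first_swap_first id_comp)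
  then show ?case using g by metis
next
  case (act x g)
  then obtain g0 g1 where g: "g0 \<in> sunic_elems f" "g1 \<in> sunic_elems f"
    "g = pair g0 g1 \<or> g = swap_first \<circ> pair g0 g1" by blast
  let ?a = "act_A (sunic_omega f x)" and ?b = "act_B f (sunic_rho f x)"
  have in_G: "?a \<circ> h \<in> sunic_elems f" "?b \<circ> h \<in> sunic_elems f" if "h \<in> sunic_elems f" for h
    using that by (auto intro!: sunic_elems_comp act_A_in act_B_in sunic_rho_in_B simp del: comp_apply)
  have x: "act_B f x = pair ?a ?b" by (rule act_B_pair)
  have 1: "act_B f x \<circ> pair g0 g1 = pair (?a \<circ> g0) (?b \<circ> g1)"
    unfolding x pair_comp ..
  have "act_B f x \<circ> (swap_first \<circ> pair g0 g1) = swap_first \<circ> (pair ?b ?a \<circ> pair g0 g1)"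
    unfolding x comp_assoc[symmetric] swap_first_pair[of ?b ?a] ..
  then have 2: "act_B f x \<circ> (swap_first \<circ> pair g0 g1) = swap_first \<circ> pair (?b \<circ> g0) (?a \<circ> g1)"
    unfolding pair_comp .
  from g(3) show ?case
  proof
    assume "g = pair g0 g1"
    then show ?thesis using 1 in_G g by blast
  next
    assume "g = swap_first \<circ> pair g0 g1"
    then show ?thesis using 2 in_G g by blast
  qed
qed

section \<open>Regular branching and the finite index of \<open>K\<close>\<close>

locale sunic2 = sunic +
  assumes deg2: "degree f \<ge> 2"
begin

abbreviation "z \<equiv> sunic_b (m - 1)"
abbreviation "b0 \<equiv> sunic_b 0"

text \<open>For \<open>m \<ge> 2\<close> the indices 0 and \<open>m - 1\<close> differ. So
  \<open>z\<close> lies in \<open>B2\<close> but outside the kernel of \<open>\<omega>\<close>,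
  while \<open>b0\<close>, which represents the nontrivial class of \<open>B\<close> modulo
  \<open>B2\<close>, lies in the kernel.\<close>

lemma z_in: "z \<in> B2" and z_omega: "\<omega> z = 1"
  and b0_in: "b0 \<in> B" and b0_omega: "\<omega> b0 = 0"
  using deg2 by (auto simp: B2_def sunic_B_def omega_apply sunic_b_def)

text \<open>It suffices to realise the generators as sections at the vertex 1: \<open>a\<close> is
  the section of \<open>a z a\<close>, and a letter of \<open>B\<close> is the section of its
  preimage under the surjection \<open>\<rho>\<close>.\<close>

lemma self_replicating: "g \<in> G \<Longrightarrow> \<exists>h\<in>G. pair h g \<in> G"
proof (induction rule: sunic_elems.induct)
  case id
  then show ?case using sunic_elems.id by (intro bexI[of _ id]) (simp_all only: pair_id)
next
  case (swap g)
  then obtain h where h: "h \<in> G" "pair h g \<in> G" by blast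
  have "pair (\<beta> (\<rho> z)) swp = swp \<circ> \<beta> z \<circ> swp"
    unfolding act_B_nonkernel[OF z_omega] swap_conj_pair ..
  then have "pair (\<beta> (\<rho> z)) swp \<in> G"
    using swap_first_in act_B_in[OF B2_subset[OF z_in]] by (simp only: sunic_elems_comp)
  from sunic_elems_comp[OF this h(2)] have "pair (\<beta> (\<rho> z) \<circ> h) (swp \<circ> g) \<in> G"
    unfolding pair_comp .
  moreover have "\<beta> (\<rho> z) \<circ> h \<in> G"
    using h act_B_in sunic_rho_in_B sunic_elems_comp by blast
  ultimately show ?case by blast
next
  case (act x g)
  then obtain h where h: "h \<in> G" "pair h g \<in> G" by blast
  obtain y where y: "y \<in> B" "x = \<rho> y"
    using act(1) rho_image by blast
  have "\<beta> y \<circ> pair h g = pair (act_A (\<omega> y) \<circ> h) (\<beta> x \<circ> g)"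
    using act_B_pair[of f y] pair_comp y(2) by metis
  then have "pair (act_A (\<omega> y) \<circ> h) (\<beta> x \<circ> g) \<in> G"
    using h y act_B_in sunic_elems_comp by metis
  then show ?case using h act_A_in sunic_elems_comp by blast
qed

lemma pair_swap_in: "pair g h \<in> G \<Longrightarrow> pair h g \<in> G"
  using sunic_elems_comp[OF sunic_elems_comp[OF swap_first_in, of "pair g h"] swap_first_in]
  unfolding swap_conj_pair .

lemma r_branch:
  assumes "y \<in> B2"
  shows "pair id (r y) \<in> K"
proof -
  obtain x where x: "x \<in> B" "\<omega> x = 0" "\<rho> x = y" using B2_preimage[OF assms] .
  define u where "u = swp \<circ> \<beta> z \<circ> swp"
  have u: "u = pair (\<beta> (\<rho> z)) swp"
    unfolding u_def act_B_nonkernel[OF z_omega] swap_conj_pair ..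
  have "\<beta> x \<circ> u \<circ> \<beta> x \<circ> u = pair id (r y)"
    unfolding act_B_kernel[OF x(2)] u x(3) pair_comp r_def
    by (simp only: id_comp comp_id act_B_act_B)
  \<comment> \<open>As \<open>z\<close> commutes with \<open>x\<close> and squares to the identity,
    \<open>x u x u = x (u z) x (z u)\<close>. Both \<open>u z\<close> and \<open>z u\<close> belong
    to \<open>K\<close>.\<close>
  moreover have "\<beta> x \<circ> u \<circ> \<beta> x \<circ> u =
      (\<beta> x \<circ> (swp \<circ> \<beta> z \<circ> swp \<circ> \<beta> z) \<circ> invf (\<beta> x)) \<circ> r z"
  proof
    fix w
    have "\<beta> z (\<beta> x (\<beta> z v)) = \<beta> x v" for v
      by (subst act_B_commute) simp
    then show "(\<beta> x \<circ> u \<circ> \<beta> x \<circ> u) w =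
      ((\<beta> x \<circ> (swp \<circ> \<beta> z \<circ> swp \<circ> \<beta> z) \<circ> invf (\<beta> x)) \<circ> r z) w"
      by (simp add: u_def r_def)
  qed
  moreover have "\<dots> \<in> K"
    by (intro K_comp K_conj swap_r_in_K r_in_K z_in act_B_in x)
  ultimately show ?thesis by simp
qed

text \<open>The group is regular branch over \<open>K\<close>: the generator \<open>r y\<close> of \<open>K\<close>, placed at the vertex 1, is
  the commutator of \<open>x\<close>, where \<open>y = \<rho> x\<close> and \<open>\<omega> x = 0\<close>, with a conjugate of \<open>z\<close>; and modulo \<open>K\<close>
  that conjugate agrees with \<open>z\<close>, which commutes with \<open>x\<close>.\<close>

lemma K_branch: "k \<in> K \<Longrightarrow> pair id k \<in> K"
proof (induction rule: K.induct)
  case id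
  show ?case using K.id by (simp only: pair_id)
next
  case (conj g y k)
  obtain h where h: "h \<in> G" "pair h g \<in> G" using self_replicating[OF conj(1)] by blast
  have 1: "h \<circ> invf h = id" using inv_apply[OF h(1)] by auto
  \<comment> \<open>A lift of \<open>g\<close> realises the conjugation below the vertex 1. Its
    other section \<open>h\<close> is uncontrolled, but it only conjugates the identity.\<close>
  have "pair id (g \<circ> r y \<circ> invf g \<circ> k) = pair h g \<circ> pair id (r y) \<circ> invf (pair h g) \<circ> pair id k"
    unfolding inv_pair[OF h(1) conj(1)] pair_comp comp_id 1 ..
  then show ?case
    using K_comp[OF K_conj[OF r_branch[OF conj(2)] h(2)] conj(4)] by (simp only:)
qed

lemma K_branch': "k \<in> K \<Longrightarrow> pair k id \<in> K"
  using K_conj[OF K_branch swap_first_in] unfolding inv_swap_first swap_conj_pair .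

text \<open>For a generator in \<open>B\<close> the commutator with \<open>y\<close> is trivial, and
  for \<open>a\<close> it is a conjugate of \<open>r y\<close>. The general case follows by
  composing, as \<open>K\<close> is normal.\<close>

lemma central_mod_K: "g \<in> G \<Longrightarrow> y \<in> B2 \<Longrightarrow> g \<circ> \<beta> y \<circ> invf g \<circ> \<beta> y \<in> K"
proof (induction rule: sunic_elems.induct)
  case id
  show ?case using K.id by (simp only: inv_id id_comp comp_id act_B_act_B)
next
  case (swap g)
  have "swp \<circ> g \<circ> \<beta> y \<circ> invf (swp \<circ> g) \<circ> \<beta> y
    = swp \<circ> (g \<circ> \<beta> y \<circ> invf g \<circ> \<beta> y) \<circ> invf swp \<circ> (swp \<circ> \<beta> y \<circ> swp \<circ> \<beta> y)"
    unfolding inv_comp[OF swap_first_in swap(1)] inv_swap_first by (rule ext) simp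
  then show ?case
    using K_comp[OF K_conj[OF swap(2) swap_first_in] swap_r_in_K] swap(3) by (simp only:)
next
  case (act x g)
  have "\<beta> x \<circ> g \<circ> \<beta> y \<circ> invf (\<beta> x \<circ> g) \<circ> \<beta> y
    = \<beta> x \<circ> (g \<circ> \<beta> y \<circ> invf g \<circ> \<beta> y) \<circ> invf (\<beta> x)"
    unfolding inv_comp[OF act_B_in[OF act(1)] act(2)] inv_act_B
    by (rule ext) (simp add: act_B_commute[of f x y])
  then show ?case
    using K_conj[OF act(3) act_B_in] act(1,4) by (simp only:)
qed

lemma conj_act_mod_K:
  assumes "g \<in> G" "y \<in> B2"
  obtains k where "k \<in> K" "\<beta> y \<circ> g = g \<circ> \<beta> y \<circ> k"
proof
  let ?k = "\<beta> y \<circ> (invf g \<circ> \<beta> y \<circ> invf (invf g) \<circ> \<beta> y) \<circ> invf (\<beta> y)"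
  show "?k \<in> K"
    using assms by (intro K_conj central_mod_K sunic_elems_inv act_B_in B2_subset)
  show "\<beta> y \<circ> g = g \<circ> \<beta> y \<circ> ?k"
    unfolding inv_inv[OF assms(1)] inv_act_B by (rule ext) (simp add: inv_apply[OF assms(1)])
qed

text \<open>The words that represent the group generated by \<open>a\<close> and \<open>b0\<close>:
  the relation \<open>(a b0)^4 = 1\<close> leaves at most eight elements, as in the dihedral group
  of order 8.\<close>

definition W :: "(vertex \<Rightarrow> vertex) set" where
  "W = (let x = \<beta> b0; s = swp in
    {id, s, x, s \<circ> x, x \<circ> s, s \<circ> x \<circ> s, x \<circ> s \<circ> x, s \<circ> x \<circ> s \<circ> x})"

text \<open>\<open>b0\<close> lies in the kernel and so acts only below the vertex 1. Its conjugate
  by \<open>a\<close> acts only below 0, hence the two commute.\<close>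

lemma swap_b0_order: "\<beta> b0 (swp (\<beta> b0 (swp w))) = swp (\<beta> b0 (swp (\<beta> b0 w)))"
proof -
  have *: "swp \<circ> \<beta> b0 \<circ> swp = pair (\<beta> (\<rho> b0)) id"
    unfolding act_B_kernel[OF b0_omega] swap_conj_pair ..
  have "\<beta> b0 \<circ> (swp \<circ> \<beta> b0 \<circ> swp) = (swp \<circ> \<beta> b0 \<circ> swp) \<circ> \<beta> b0"
    unfolding * unfolding act_B_kernel[OF b0_omega] pair_comp id_comp comp_id ..
  from fun_cong[OF this, of w] show ?thesis by simp
qed

lemma W_subset: "w \<in> W \<Longrightarrow> w \<in> G"
  unfolding W_def Let_def
  by (elim insertE) (auto intro!: sunic_elems_comp swap_first_in act_B_in b0_in sunic_elems.id simp del: comp_apply)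

lemma W_swap: "w \<in> W \<Longrightarrow> swp \<circ> w \<in> W"
proof -
  have "swp \<circ> (swp \<circ> h) = h" for h :: "vertex \<Rightarrow> vertex"
    by (simp only: comp_assoc[symmetric] swap_first_swap_first id_comp)
  then show "w \<in> W \<Longrightarrow> swp \<circ> w \<in> W"
    unfolding W_def Let_def comp_assoc insert_iff by (elim disjE) (simp_all only: comp_id simp_thms swap_first_swap_first empty_iff)
qed

lemma W_b0: "w \<in> W \<Longrightarrow> \<beta> b0 \<circ> w \<in> W"
proof -
  have 1: "\<beta> b0 \<circ> (\<beta> b0 \<circ> h) = h" for h :: "vertex \<Rightarrow> vertex"
    by (simp only: comp_assoc[symmetric] act_B_act_B id_comp)
  have 2: "\<beta> b0 \<circ> (swp \<circ> (\<beta> b0 \<circ> swp)) = swp \<circ> (\<beta> b0 \<circ> (swp \<circ> \<beta> b0))"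
    by (rule ext) (simp add: swap_b0_order)
  have 3: "\<beta> b0 \<circ> (swp \<circ> (\<beta> b0 \<circ> (swp \<circ> \<beta> b0))) = swp \<circ> (\<beta> b0 \<circ> swp)"
    by (rule ext) (simp add: swap_b0_order)
  show "w \<in> W \<Longrightarrow> \<beta> b0 \<circ> w \<in> W"
    unfolding W_def Let_def comp_assoc insert_iff
    by (elim disjE) (simp_all only: 1 2 3 comp_id simp_thms act_B_act_B empty_iff)
qed

lemma B_decomp:
  assumes "u \<in> B"
  obtains e y where "y \<in> B2" "e = id \<or> e = \<beta> b0" "\<beta> u = e \<circ> \<beta> y"
proof (cases "u 0 = 0")
  case True
  then have "u \<in> B2" using assms by (simp add: B2_def)
  then show ?thesis using that[of u id] by (simp only: id_comp simp_thms)
next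
  case False
  let ?y = "\<lambda>i. b0 i + u i"
  have "?y \<in> B" using assms b0_in sunic_B_add by blast
  moreover have "?y 0 = 0" using False by (simp add: sunic_b_def bit_not_zero_iff)
  ultimately have "?y \<in> B2" by (simp add: B2_def)
  moreover have "\<beta> u = \<beta> b0 \<circ> \<beta> ?y"
    unfolding act_B_comp[symmetric] comp_assoc[symmetric] act_B_act_B id_comp ..
  ultimately show ?thesis using that by blast
qed

text \<open>Left multiplication by a generator preserves the form \<open>w y k\<close>:
  \<open>a\<close> and \<open>b0\<close> stay inside \<open>W\<close>, and an element of
  \<open>B2\<close> moves past \<open>w\<close> at the cost of a factor from
  \<open>K\<close>.\<close>

lemma W_decomp: "g \<in> G \<Longrightarrow> \<exists>w\<in>W. \<exists>y\<in>B2. \<exists>k\<in>K. g = w \<circ> \<beta> y \<circ> k"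
proof (induction rule: sunic_elems.induct)
  case id
  have "id \<in> W" by (simp add: W_def Let_def)
  moreover have "(\<lambda>_. 0) \<in> B2" by (simp add: B2_def sunic_B_zero)
  moreover have "id = id \<circ> \<beta> (\<lambda>_. 0) \<circ> id" by (simp only: act_B_zero id_comp)
  ultimately show ?case using K.id by blast
next
  case (swap g)
  then obtain w y k where "w \<in> W" "y \<in> B2" "k \<in> K" "g = w \<circ> \<beta> y \<circ> k" by blast
  then show ?case
    using W_swap by (intro bexI[of _ "swp \<circ> w"] bexI[of _ y] bexI[of _ k]) (simp_all only: comp_assoc)
next
  case (act u g)
  then obtain w y k where g: "w \<in> W" "y \<in> B2" "k \<in> K" "g = w \<circ> \<beta> y \<circ> k" by blast
  obtain e y' where u: "y' \<in> B2" "e = id \<or> e = \<beta> b0" "\<beta> u = e \<circ> \<beta> y'" using B_decomp[OF act(1)] .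
  obtain k' where k': "k' \<in> K" "\<beta> y' \<circ> w = w \<circ> \<beta> y' \<circ> k'"
    using conj_act_mod_K[OF W_subset[OF g(1)] u(1)] .
  let ?y = "\<lambda>i. y' i + y i"
  let ?k = "\<beta> y \<circ> k' \<circ> invf (\<beta> y) \<circ> k"
  have "e \<circ> w \<in> W" using u(2) g(1) W_b0 by (metis id_comp)
  moreover have "?y \<in> B2" using g(2) u(1) sunic_B_add by (simp add: B2_def)
  moreover have "?k \<in> K" using K_comp[OF K_conj[OF k'(1) act_B_in] g(3)] g(2) B2_subset by blast
  moreover have "\<beta> u \<circ> g = e \<circ> w \<circ> \<beta> ?y \<circ> ?k"
  proof -
    have "\<beta> u \<circ> g = e \<circ> (\<beta> y' \<circ> w) \<circ> \<beta> y \<circ> k"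
      unfolding u(3) g(4) by (simp only: comp_assoc)
    also have "\<dots> = e \<circ> w \<circ> \<beta> ?y \<circ> ?k"
      unfolding k'(2) act_B_comp[symmetric] inv_act_B by (rule ext) simp
    finally show ?thesis .
  qed
  ultimately show ?case by blast
qed

lemma K_cover: "\<exists>F. finite F \<and> F \<subseteq> G \<and> (\<forall>g\<in>G. \<exists>h\<in>F. \<exists>k\<in>K. g = h \<circ> k)"
proof -
  let ?F = "(\<lambda>(w, y). w \<circ> \<beta> y) ` (W \<times> B2)"
  have "finite W" by (simp add: W_def Let_def)
  moreover have "finite B2" using finite_sunic_B by (simp add: B2_def)
  ultimately have "finite ?F" by simp
  moreover have "?F \<subseteq> G"
    using W_subset B2_subset act_B_in sunic_elems_comp by fast
  moreover have "\<forall>g\<in>G. \<exists>h\<in>?F. \<exists>k\<in>K. g = h \<circ> k"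
    using W_decomp by fast
  ultimately show ?thesis by blast
qed

text \<open>Modulo \<open>K\<close>, \<open>u\<close> is \<open>e\<close> times a central
  involution, so the fourth power reduces to \<open>(a e)^4\<close>, which is trivial. This is
  needed for the fixed element \<open>b\<close>, which is not in \<open>B2\<close> and for which no
  relation \<open>(a y)^(2^k) = 1\<close> is available.\<close>

lemma swap_act_pow4:
  assumes "u \<in> B"
  shows "(swp \<circ> \<beta> u) ^^ (2 ^ Suc (Suc 0)) \<in> K"
proof -
  obtain e y where u: "y \<in> B2" "e = id \<or> e = \<beta> b0" "\<beta> u = e \<circ> \<beta> y" using B_decomp[OF assms] .
  define q where "q = swp \<circ> e \<circ> swp \<circ> e"
  have q: "q \<circ> q = id"
    using u(2) by (auto simp: q_def fun_eq_iff swap_b0_order)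
  have e_in: "swp \<circ> e \<in> G"
    using u(2) sunic_elems.id b0_in act_B_in swap_first_in sunic_elems_comp by metis
  have ie: "invf (swp \<circ> e) (swp (e v)) = v" for v
    using inv_apply(1)[OF e_in, of v] by simp
  define c where "c = (swp \<circ> e) \<circ> \<beta> y \<circ> invf (swp \<circ> e) \<circ> \<beta> y"
  have c: "c \<in> K" unfolding c_def by (rule central_mod_K[OF e_in u(1)])
  define p where "p = \<beta> y \<circ> q \<circ> \<beta> y"
  have "q = (swp \<circ> e) \<circ> (swp \<circ> e)" unfolding q_def by (simp only: comp_assoc)
  then have p_in: "p \<in> G" unfolding p_def
    using e_in act_B_in[OF B2_subset[OF u(1)]] by (simp only: sunic_elems_comp)
  have "p \<circ> p = \<beta> y \<circ> (q \<circ> q) \<circ> \<beta> y" unfolding p_def by (rule ext) simp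
  then have pp: "p \<circ> p = id" by (simp only: q comp_id act_B_act_B)
  have "(swp \<circ> \<beta> u) \<circ> (swp \<circ> \<beta> u) = c \<circ> p"
    unfolding c_def p_def q_def u(3) by (rule ext) (simp add: ie)
  then have "(swp \<circ> \<beta> u) ^^ (2 ^ Suc (Suc 0)) = c \<circ> p \<circ> (c \<circ> p)"
    by (simp only: funpow_power2_Suc power_0 funpow.simps(2) One_nat_def funpow.simps(1) comp_id)
  also have "\<dots> = c \<circ> (p \<circ> c \<circ> invf p)"
    unfolding involution_inv(2)[OF pp] by (simp only: comp_assoc)
  also have "\<dots> \<in> K" by (intro K_comp K_conj c p_in)
  finally show ?thesis .
qed

section \<open>The derived subgroup \<open>D\<close> of \<open>K\<close> and its finite
  index\<close>

abbreviation "D \<equiv> derived (sunic_group f) K"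

lemma D_normal: "D \<lhd> sunic_group f"
  by (rule group.derived_is_normal[OF group_sunic_group K_normal])

lemmas D_rules = normal_sunicD[OF D_normal]

lemma commutator_in_D: "k \<in> K \<Longrightarrow> k' \<in> K \<Longrightarrow> k \<circ> k' \<circ> invf k \<circ> invf k' \<in> D"
  unfolding derived_def by (rule generate.incl) (use K_subset in force)

lemma K_commute:
  assumes "k \<in> K" "k' \<in> K"
  obtains d where "d \<in> D" "k \<circ> k' = k' \<circ> k \<circ> d"
proof
  let ?d = "invf k \<circ> invf k' \<circ> invf (invf k) \<circ> invf (invf k')"
  show "?d \<in> D" using assms by (intro commutator_in_D K_inv)
  show "k \<circ> k' = k' \<circ> k \<circ> ?d"
    unfolding inv_inv[OF K_subset[OF assms(1)]] inv_inv[OF K_subset[OF assms(2)]]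
    by (rule ext) (simp add: inv_apply[OF K_subset[OF assms(1)]] inv_apply[OF K_subset[OF assms(2)]])
qed

lemma D_shift:
  assumes "d \<in> D" "g \<in> G"
  obtains d' where "d' \<in> D" "d \<circ> g = g \<circ> d'"
proof
  show "invf g \<circ> d \<circ> invf (invf g) \<in> D"
    using assms D_rules(5) sunic_elems_inv by blast
  show "d \<circ> g = g \<circ> (invf g \<circ> d \<circ> invf (invf g))"
    unfolding inv_inv[OF assms(2)] by (rule ext) (simp add: inv_apply[OF assms(2)])
qed

lemma K_funpow: "k \<in> K \<Longrightarrow> k ^^ n \<in> K"
  by (induction n) (simp_all only: funpow.simps K.id K_comp)

lemma power_mod_D:
  assumes "p \<in> K" "k \<in> K"
  shows "\<exists>d\<in>D. (p \<circ> k) ^^ n = p ^^ n \<circ> k ^^ n \<circ> d"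
proof (induction n)
  case 0
  show ?case using D_rules(2) by (intro bexI[of _ id]) (simp_all only: funpow.simps id_comp)
next
  case (Suc n)
  then obtain d where d: "d \<in> D" "(p \<circ> k) ^^ n = p ^^ n \<circ> k ^^ n \<circ> d" by blast
  obtain c where c: "c \<in> D" "k \<circ> p ^^ n = p ^^ n \<circ> k \<circ> c"
    using K_commute[OF assms(2) K_funpow[OF assms(1)]] .
  obtain c' where c': "c' \<in> D" "c \<circ> k ^^ n = k ^^ n \<circ> c'"
    using D_shift[OF c(1) K_subset[OF K_funpow[OF assms(2)]]] .
  have "(p \<circ> k) ^^ Suc n = p \<circ> (k \<circ> p ^^ n) \<circ> k ^^ n \<circ> d"
    unfolding funpow.simps d(2) by (simp only: comp_assoc)
  also have "\<dots> = p \<circ> p ^^ n \<circ> k \<circ> (c \<circ> k ^^ n) \<circ> d"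
    unfolding c(2) by (simp only: comp_assoc)
  also have "\<dots> = p ^^ Suc n \<circ> k ^^ Suc n \<circ> (c' \<circ> d)"
    unfolding c'(2) funpow.simps by (simp only: comp_assoc)
  finally show ?case using D_rules(3)[OF c'(1) d(1)] by blast
qed

lemma funpow_power2_mono:
  fixes g :: "'a \<Rightarrow> 'a"
  assumes "g ^^ (2 ^ i) = id" "i \<le> j"
  shows "g ^^ (2 ^ j) = id"
proof -
  have "g ^^ (2 ^ j) = (g ^^ (2 ^ i)) ^^ (2 ^ (j - i))"
    using assms(2) by (simp add: funpow_mult flip: power_add)
  then show ?thesis by (simp only: assms id_funpow)
qed

lemma D_funpow: "d \<in> D \<Longrightarrow> d ^^ n \<in> D"
  by (induction n) (simp_all only: funpow.simps D_rules)

text \<open>The quotient of \<open>K\<close> by \<open>D\<close> is abelian and generated by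
  elements of 2-power order, so exponents of two factors can be combined.\<close>

lemma K_power_in_D: "k \<in> K \<Longrightarrow> \<exists>e. k ^^ (2 ^ e) \<in> D"
proof (induction rule: K.induct)
  case id
  show ?case using D_rules(2) by (intro exI[of _ 0]) (simp only: id_funpow)
next
  case (conj g y k)
  then obtain e where e: "k ^^ (2 ^ e) \<in> D" by blast
  obtain i where i: "r y ^^ (2 ^ i) = id" using r_torsion[OF conj(2)] by blast
  let ?p = "g \<circ> r y \<circ> invf g"
  have g: "g \<circ> invf g = id" "invf g \<circ> g = id" using inv_apply[OF conj(1)] by auto
  have "?p ^^ (2 ^ i) = id" unfolding funpow_conj[OF g(2,1)] i comp_id g(1) ..
  then have p: "?p ^^ (2 ^ (e + i)) = id" by (rule funpow_power2_mono) simp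
  have k: "k ^^ (2 ^ (e + i)) \<in> D"
    using D_funpow[OF e, of "2 ^ i"] unfolding funpow_mult power_add .
  obtain d where d: "d \<in> D" "(?p \<circ> k) ^^ (2 ^ (e + i)) = ?p ^^ (2 ^ (e + i)) \<circ> k ^^ (2 ^ (e + i)) \<circ> d"
    using power_mod_D[OF K_gen[OF conj(1,2)] conj(3)] by blast
  have "(?p \<circ> k) ^^ (2 ^ (e + i)) \<in> D"
    unfolding d(2) p id_comp by (rule D_rules(3)[OF k d(1)])
  then show ?case by blast
qed

text \<open>Finitely many elements of finite order that commute modulo \<open>D\<close> have only
  finitely many products modulo \<open>D\<close>. The set \<open>F\<close> collects these products;
  absorption under left multiplication by \<open>S\<close> is what an induction over words can
  use.\<close>

lemma finite_abelian_cover: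
  assumes "finite S" "\<And>s. s \<in> S \<Longrightarrow> s \<in> K \<and> (\<exists>n>0. s ^^ n = id)"
  shows "\<exists>F. finite F \<and> id \<in> F \<and> F \<subseteq> K \<and> (\<forall>s\<in>S. \<forall>h\<in>F. \<exists>h'\<in>F. \<exists>d\<in>D. s \<circ> h = h' \<circ> d)"
  using assms
proof (induction S rule: finite_induct)
  case empty
  show ?case using K.id by blast
next
  case (insert s S)
  have "s' \<in> K \<and> (\<exists>n>0. s' ^^ n = id)" if "s' \<in> S" for s'
    using insert.prems that by blast
  from insert.IH[OF this] obtain F where F: "finite F" "id \<in> F" "F \<subseteq> K"
    "\<forall>s\<in>S. \<forall>h\<in>F. \<exists>h'\<in>F. \<exists>d\<in>D. s \<circ> h = h' \<circ> d" by blast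
  from insert.prems[of s] obtain n where s: "s \<in> K" "n > 0" "s ^^ n = id" by blast
  let ?F = "{s ^^ i \<circ> h | i h. i < n \<and> h \<in> F}"
  have "s ^^ 0 \<circ> id \<in> ?F" using F(2) s(2) by blast
  then have id_F: "id \<in> ?F" by (simp only: funpow.simps id_comp)
  have F_K: "?F \<subseteq> K" using F(3) K_funpow[OF s(1)] K_comp by blast
  have step: "\<exists>h'\<in>?F. \<exists>d\<in>D. s' \<circ> h = h' \<circ> d" if "s' \<in> insert s S" "h \<in> ?F" for s' h
  proof -
    from that(2) obtain i h0 where h: "i < n" "h0 \<in> F" "h = s ^^ i \<circ> h0" by blast
    show ?thesis
    proof (cases "s' = s")
      case True
      \<comment> \<open>The exponent of \<open>s\<close> wraps around modulo its order
        \<open>n\<close>, which keeps the set finite.\<close>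
      have "s \<circ> h = s ^^ (Suc i mod n) \<circ> h0"
      proof (cases "Suc i = n")
        case True
        then have "s \<circ> s ^^ i = id" using s(3) by (simp only: funpow.simps flip: True)
        then show ?thesis
          unfolding h(3) comp_assoc[symmetric] using True by (simp only: mod_self funpow.simps)
      next
        case False
        then have "Suc i mod n = Suc i" using h(1) by simp
        then show ?thesis unfolding h(3) by (simp only: funpow.simps comp_assoc)
      qed
      moreover have "Suc i mod n < n" using s(2) by simp
      ultimately have "s' \<circ> h \<in> ?F" using h(2) True by blast
      then show ?thesis using D_rules(2) by (intro bexI[of _ "s' \<circ> h"] bexI[of _ id]) (simp_all only: comp_id)
    next
      case False
      then have s': "s' \<in> S" "s' \<in> K" using that(1) insert.prems by auto
      obtain c where c: "c \<in> D" "s' \<circ> s ^^ i = s ^^ i \<circ> s' \<circ> c"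
        using K_commute[OF s'(2) K_funpow[OF s(1)]] .
      have h0: "h0 \<in> K" using h(2) F(3) by blast
      obtain c' where c': "c' \<in> D" "c \<circ> h0 = h0 \<circ> c'" using D_shift[OF c(1) K_subset[OF h0]] .
      obtain h1 d where h1: "h1 \<in> F" "d \<in> D" "s' \<circ> h0 = h1 \<circ> d" using F(4) s'(1) h(2) by blast
      have "s' \<circ> h = (s' \<circ> s ^^ i) \<circ> h0" unfolding h(3) by (simp only: comp_assoc)
      also have "\<dots> = s ^^ i \<circ> s' \<circ> (c \<circ> h0)" unfolding c(2) by (simp only: comp_assoc)
      also have "\<dots> = s ^^ i \<circ> (s' \<circ> h0) \<circ> c'" unfolding c'(2) by (simp only: comp_assoc)
      also have "\<dots> = (s ^^ i \<circ> h1) \<circ> (d \<circ> c')" unfolding h1(3) by (simp only: comp_assoc)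
      finally have "s' \<circ> h = (s ^^ i \<circ> h1) \<circ> (d \<circ> c')" .
      moreover have "s ^^ i \<circ> h1 \<in> ?F" using h(1) h1(1) by blast
      ultimately show ?thesis using D_rules(3)[OF h1(2) c'(1)] by blast
    qed
  qed
  have "finite ?F" using F(1) by (intro finite_image_set2) simp_all
  then show ?case
    by (intro exI[of _ ?F] conjI ballI id_F F_K step)
qed

text \<open>Write \<open>g = t k0\<close> with \<open>t\<close> from the finite set \<open>T\<close>
  and \<open>k0\<close> in \<open>K\<close>. Since \<open>k0\<close> commutes with
  \<open>r y\<close> modulo \<open>D\<close>, the generator obtained from \<open>g\<close> agrees
  modulo \<open>D\<close> with the one obtained from \<open>t\<close>. So finitely many generators
  of finite order remain.\<close>

lemma D_cover: "\<exists>F. finite F \<and> (\<forall>g\<in>G. \<exists>h\<in>F. \<exists>d\<in>D. g = h \<circ> d)"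
proof -
  obtain T where T: "finite T" "T \<subseteq> G" "\<And>g. g \<in> G \<Longrightarrow> \<exists>h\<in>T. \<exists>k\<in>K. g = h \<circ> k"
    using K_cover by blast
  let ?S = "{t \<circ> r y \<circ> invf t | t y. t \<in> T \<and> y \<in> B2}"
  have "finite B2" using finite_sunic_B by (simp add: B2_def)
  then have fin: "finite ?S" using T(1) by (intro finite_image_set2) simp_all
  have S: "s \<in> K \<and> (\<exists>n>0. s ^^ n = id)" if s: "s \<in> ?S" for s
  proof -
    from s obtain t y where s: "t \<in> T" "y \<in> B2" "s = t \<circ> r y \<circ> invf t" by blast
    obtain i where i: "r y ^^ (2 ^ i) = id" using r_torsion[OF s(2)] by blast
    have t: "t \<in> G" using s(1) T(2) by blast
    have t': "t \<circ> invf t = id" "invf t \<circ> t = id" using inv_apply[OF t] by auto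
    have "s ^^ (2 ^ i) = id" unfolding s(3) funpow_conj[OF t'(2,1)] i comp_id t'(1) ..
    moreover have "(2::nat) ^ i > 0" by simp
    ultimately show ?thesis using K_gen[OF t s(2)] s(3) by blast
  qed
  from finite_abelian_cover[OF fin S] obtain F where
    *: "finite F \<and> id \<in> F \<and> F \<subseteq> K \<and> (\<forall>s\<in>?S. \<forall>h\<in>F. \<exists>h'\<in>F. \<exists>d\<in>D. s \<circ> h = h' \<circ> d)"
    by (rule exE)
  note F = *[THEN conjunct1] *[THEN conjunct2, THEN conjunct1]
    *[THEN conjunct2, THEN conjunct2, THEN conjunct1]
  note F_step = *[THEN conjunct2, THEN conjunct2, THEN conjunct2]
  have K: "\<exists>h\<in>F. \<exists>d\<in>D. k = h \<circ> d" if "k \<in> K" for k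
    using that
  proof (induction rule: K.induct)
    case id
    have "id = id \<circ> id" by simp
    then show ?case using F(2) D_rules(2) by blast
  next
    case (conj g y k)
    then obtain h d where k: "h \<in> F" "d \<in> D" "k = h \<circ> d" by blast
    obtain t k0 where t: "t \<in> T" "k0 \<in> K" "g = t \<circ> k0" using T(3)[OF conj(1)] by blast
    have tG: "t \<in> G" using t(1) T(2) by blast
    have hG: "h \<in> G" using k(1) F(3) K_subset by blast
    obtain c where c: "c \<in> D" "k0 \<circ> r y = r y \<circ> k0 \<circ> c" using K_commute[OF t(2) r_in_K[OF conj(2)]] .
    obtain c1 where c1: "c1 \<in> D" "c \<circ> invf g = invf g \<circ> c1"
      using D_shift[OF c(1) sunic_elems_inv[OF conj(1)]] .
    obtain c2 where c2: "c2 \<in> D" "c1 \<circ> h = h \<circ> c2" using D_shift[OF c1(1) hG] .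
    have "t \<circ> r y \<circ> invf t \<in> ?S" using t(1) conj(2) by blast
    from bspec[OF bspec[OF F_step this] k(1)] obtain h' d' where h': "h' \<in> F" "d' \<in> D"
      "t \<circ> r y \<circ> invf t \<circ> h = h' \<circ> d'" by blast
    have "g \<circ> r y \<circ> invf g = t \<circ> (k0 \<circ> r y) \<circ> invf g"
      unfolding t(3) by (simp only: comp_assoc)
    also have "\<dots> = t \<circ> r y \<circ> k0 \<circ> (c \<circ> invf g)" unfolding c(2) by (simp only: comp_assoc)
    also have "\<dots> = t \<circ> r y \<circ> (k0 \<circ> invf g) \<circ> c1" unfolding c1(2) by (simp only: comp_assoc)
    also have "k0 \<circ> invf g = invf t"
      unfolding t(3) inv_comp[OF tG K_subset[OF t(2)]] by (rule ext) (simp add: inv_apply[OF K_subset[OF t(2)]])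
    finally have "g \<circ> r y \<circ> invf g \<circ> k = t \<circ> r y \<circ> invf t \<circ> (c1 \<circ> h) \<circ> d"
      unfolding k(3) by (simp only: comp_assoc)
    also have "\<dots> = (t \<circ> r y \<circ> invf t \<circ> h) \<circ> c2 \<circ> d" unfolding c2(2) by (simp only: comp_assoc)
    also have "\<dots> = h' \<circ> (d' \<circ> (c2 \<circ> d))" unfolding h'(3) by (simp only: comp_assoc)
    finally show ?case using h' D_rules(3)[OF h'(2) D_rules(3)[OF c2(1) k(2)]] by blast
  qed
  let ?F = "{t \<circ> h | t h. t \<in> T \<and> h \<in> F}"
  have "\<exists>h\<in>?F. \<exists>d\<in>D. g = h \<circ> d" if g_in: "g \<in> G" for g
  proof -
    obtain t k where g: "t \<in> T" "k \<in> K" "g = t \<circ> k" using T(3)[OF g_in] by blast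
    obtain h d where k: "h \<in> F" "d \<in> D" "k = h \<circ> d" using K[OF g(2)] by blast
    have "g = (t \<circ> h) \<circ> d" unfolding g(3) k(3) by (simp only: comp_assoc)
    moreover have "t \<circ> h \<in> ?F" using g(1) k(1) by blast
    ultimately show ?thesis using k(2) by blast
  qed
  moreover have "finite ?F" using T(1) F(1) by (intro finite_image_set2) simp_all
  ultimately show ?thesis by blast
qed

end

section \<open>Nontrivial normal subgroups\<close>

fun at_vertex :: "vertex \<Rightarrow> (vertex \<Rightarrow> vertex) \<Rightarrow> vertex \<Rightarrow> vertex" where
  "at_vertex [] g = g"
| "at_vertex (False # v) g = pair (at_vertex v g) id"
| "at_vertex (True # v) g = pair id (at_vertex v g)"

lemma at_vertex_comp: "at_vertex v (g \<circ> h) = at_vertex v g \<circ> at_vertex v h"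
  by (induction v g rule: at_vertex.induct) (simp_all only: at_vertex.simps pair_comp id_comp)

lemma at_vertex_apply:
  "at_vertex v g w = (if take (length v) w = v then v @ g (drop (length v) w) else w)"
proof (induction v g arbitrary: w rule: at_vertex.induct)
  case (2 v g)
  then show ?case by (cases w) (auto simp: pair_def)
next
  case (3 v g)
  then show ?case by (cases w) (auto simp: pair_def)
qed simp

text \<open>The direct product of copies of \<open>P\<close> at all \<open>2^n\<close> vertices of
  level \<open>n\<close>. The recursion over sections fits the passage from one level to the
  next.\<close>

fun level_product :: "nat \<Rightarrow> (vertex \<Rightarrow> vertex) set \<Rightarrow> (vertex \<Rightarrow> vertex) set" where
  "level_product 0 P = P"
| "level_product (Suc n) P = {pair g h | g h. g \<in> level_product n P \<and> h \<in> level_product n P}"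

text \<open>\<open>N\<close> is an arbitrary set closed under composition, so that the induction may
  replace it by the set of those \<open>p\<close> for which \<open>pair p id\<close>, respectively
  \<open>pair id p\<close>, lies in \<open>N\<close>.\<close>

lemma level_product_subset:
  assumes "\<And>v p. length v = n \<Longrightarrow> p \<in> P \<Longrightarrow> at_vertex v p \<in> N"
    and "\<And>g h. g \<in> N \<Longrightarrow> h \<in> N \<Longrightarrow> g \<circ> h \<in> N"
    and "g \<in> level_product n P"
  shows "g \<in> N"
  using assms
proof (induction n arbitrary: N g)
  case 0
  from 0(1)[of "[]" g] 0(3) show ?case by simp
next
  case (Suc n)
  from Suc.prems(3) obtain g0 g1 where g: "g0 \<in> level_product n P" "g1 \<in> level_product n P" "g = pair g0 g1"
    by auto
  have "g0 \<in> {p. pair p id \<in> N}"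
  proof (rule Suc.IH[OF _ _ g(1)])
    show "at_vertex v p \<in> {p. pair p id \<in> N}" if "length v = n" "p \<in> P" for v p
      using Suc.prems(1)[of "False # v" p] that by simp
    show "p \<circ> q \<in> {p. pair p id \<in> N}" if "p \<in> {p. pair p id \<in> N}" "q \<in> {p. pair p id \<in> N}" for p q
      using Suc.prems(2)[of "pair p id" "pair q id"] that unfolding pair_comp id_comp mem_Collect_eq by blast
  qed
  moreover have "g1 \<in> {p. pair id p \<in> N}"
  proof (rule Suc.IH[OF _ _ g(2)])
    show "at_vertex v p \<in> {p. pair id p \<in> N}" if "length v = n" "p \<in> P" for v p
      using Suc.prems(1)[of "True # v" p] that by simp
    show "p \<circ> q \<in> {p. pair id p \<in> N}" if "p \<in> {p. pair id p \<in> N}" "q \<in> {p. pair id p \<in> N}" for p q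
      using Suc.prems(2)[of "pair id p" "pair id q"] that unfolding pair_comp id_comp mem_Collect_eq by blast
  qed
  ultimately have "pair g0 id \<circ> pair id g1 \<in> N"
    using Suc.prems(2) by blast
  then show ?case unfolding g(3) pair_comp id_comp comp_id .
qed

text \<open>Up to a swap an element is a pair of group elements, so pairs from \<open>F\<close>,
  with and without a swap, cover the next level. Such pairs may leave the group, which is why
  \<open>F\<close> is just a finite set of functions.\<close>

lemma level_product_cover:
  assumes "\<exists>F. finite F \<and> (\<forall>g\<in>sunic_elems f. \<exists>h\<in>F. \<exists>p\<in>P. g = h \<circ> p)"
  shows "\<exists>F. finite F \<and> (\<forall>g\<in>sunic_elems f. \<exists>h\<in>F. \<exists>p\<in>level_product n P. g = h \<circ> p)"
proof (induction n)
  case 0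
  then show ?case using assms by (simp only: level_product.simps)
next
  case (Suc n)
  then obtain F where F: "finite F" "\<And>g. g \<in> sunic_elems f \<Longrightarrow> \<exists>h\<in>F. \<exists>p\<in>level_product n P. g = h \<circ> p"
    by blast
  let ?E = "{pair g h | g h. g \<in> F \<and> h \<in> F}"
  let ?F = "?E \<union> (\<lambda>g. swap_first \<circ> g) ` ?E"
  have E: "\<exists>e\<in>?E. \<exists>p\<in>level_product (Suc n) P. pair g0 g1 = e \<circ> p"
    if g: "g0 \<in> sunic_elems f" "g1 \<in> sunic_elems f" for g0 g1
  proof -
    obtain h0 p0 where 0: "h0 \<in> F" "p0 \<in> level_product n P" "g0 = h0 \<circ> p0" using F(2)[OF g(1)] by blast
    obtain h1 p1 where 1: "h1 \<in> F" "p1 \<in> level_product n P" "g1 = h1 \<circ> p1" using F(2)[OF g(2)] by blast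
    have "pair g0 g1 = pair h0 h1 \<circ> pair p0 p1" unfolding 0(3) 1(3) pair_comp ..
    moreover have "pair h0 h1 \<in> ?E" using 0 1 by blast
    moreover have "pair p0 p1 \<in> level_product (Suc n) P" using 0 1 by auto
    ultimately show ?thesis by blast
  qed
  have cover: "\<exists>h\<in>?F. \<exists>p\<in>level_product (Suc n) P. g = h \<circ> p" if g_in: "g \<in> sunic_elems f" for g
  proof -
    obtain g0 g1 where g: "g0 \<in> sunic_elems f" "g1 \<in> sunic_elems f"
      "g = pair g0 g1 \<or> g = swap_first \<circ> pair g0 g1" using sunic_elems_pair[OF g_in] by blast
    obtain e p where e: "e \<in> ?E" "p \<in> level_product (Suc n) P" "pair g0 g1 = e \<circ> p"
      using E[OF g(1,2)] by blast
    have "swap_first \<circ> pair g0 g1 = (swap_first \<circ> e) \<circ> p" unfolding e(3) by (simp only: comp_assoc)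
    then have "g = e \<circ> p \<or> g = (swap_first \<circ> e) \<circ> p" using g(3) e(3) by metis
    moreover have F: "e \<in> ?F" "swap_first \<circ> e \<in> ?F" using e(1) by blast+
    ultimately show ?thesis
      by (elim disjE) (rule bexI[OF bexI[OF _ e(2)] F(1)] bexI[OF bexI[OF _ e(2)] F(2)]; assumption)+
  qed
  have "finite ?F" using F(1) by (intro finite_UnI finite_imageI finite_image_set2) simp_all
  then show ?case by (intro exI[of _ ?F] conjI ballI cover)
qed

section \<open>Copies of \<open>D\<close> inside normal subgroups\<close>

context sunic2
begin

lemma at_vertex_in_K: "k \<in> K \<Longrightarrow> at_vertex v k \<in> K"
  by (induction v k rule: at_vertex.induct) (simp_all only: at_vertex.simps K_branch K_branch')

lemma inv_at_vertex:
  assumes "g \<in> G"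
  shows "invf (at_vertex v g) = at_vertex v (invf g)"
proof -
  have "at_vertex v id = id" by (rule ext) (auto simp: at_vertex_apply, metis append_take_drop_id)
  moreover have "g \<circ> invf g = id" "invf g \<circ> g = id" using inv_apply[OF assms] by auto
  ultimately show ?thesis by (intro inv_eqI) (simp_all only: at_vertex_comp[symmetric])
qed

text \<open>\<open>u\<close> and \<open>g u\<close> are distinct vertices of one level, so the
  subtrees below them are disjoint. The conjugated copy acts only below \<open>g u\<close>.\<close>

lemma moved_at_vertex_commute:
  assumes "g \<in> G" "g u \<noteq> u"
  shows "(g \<circ> at_vertex u k \<circ> invf g) \<circ> at_vertex u k' = at_vertex u k' \<circ> (g \<circ> at_vertex u k \<circ> invf g)"
proof
  fix w
  let ?Q = "g \<circ> at_vertex u k \<circ> invf g" and ?n = "length u"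
  have gi: "take ?n (g v) = g (take ?n v)" "take ?n (invf g v) = invf g (take ?n v)" for v
    using sunic_elems_take[OF assms(1)] sunic_elems_take[OF sunic_elems_inv[OF assms(1)]] by blast+
  have gu: "invf g u \<noteq> u" using assms(2) inv_apply(2)[OF assms(1), of u] by metis
  have fixed: "?Q v = v" if "take ?n v = u" for v
    using gu that by (simp add: at_vertex_apply gi inv_apply[OF assms(1)])
  show "(?Q \<circ> at_vertex u k') w = (at_vertex u k' \<circ> ?Q) w"
  proof (cases "take ?n w = u")
    case True
    then have "take ?n (at_vertex u k' w) = u" by (simp add: at_vertex_apply)
    then show ?thesis using fixed True by (simp only: comp_apply[of ?Q] comp_apply[of "at_vertex u k'"])
  next
    case False
    have "take ?n (?Q w) \<noteq> u"
      using assms(2) False by (simp add: at_vertex_apply gi inv_apply[OF assms(1)])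
    then have "at_vertex u k' (?Q w) = ?Q w" by (simp only: at_vertex_apply if_False)
    moreover have "at_vertex u k' w = w" using False by (simp add: at_vertex_apply)
    ultimately show ?thesis by (simp only: comp_apply[of ?Q] comp_apply[of "at_vertex u k'"])
  qed
qed

text \<open>The commutator of \<open>g\<close> with the copy of \<open>k^-1\<close> at
  \<open>u\<close> lies in \<open>N\<close>. It is the copy of \<open>k\<close> at \<open>u\<close>
  times a factor that acts only below \<open>g u\<close> and commutes with all copies at
  \<open>u\<close>. A second commutator, with the copy of \<open>k'\<close>, therefore leaves the
  copy of the commutator of \<open>k\<close> and \<open>k'\<close>.\<close>

lemma at_moved_vertex:
  assumes "N \<lhd> sunic_group f" "g \<in> N" "g u \<noteq> u" "d \<in> D"
  shows "at_vertex u d \<in> N"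
proof -
  note N = normal_sunicD[OF assms(1)]
  have g: "g \<in> G" using assms(2) N(1) by blast
  have comm: "at_vertex u (k \<circ> k' \<circ> invf k \<circ> invf k') \<in> N" if "k \<in> K" "k' \<in> K" for k k'
  proof -
    have kG: "k \<in> G" "k' \<in> G" using that K_subset by blast+
    let ?A = "at_vertex u (invf k)" and ?B = "at_vertex u k'"
    have A_in: "?A \<in> G" and B_in: "?B \<in> G"
      using that at_vertex_in_K K_inv K_subset by blast+
    have A_inv: "invf ?A = at_vertex u k"
      using inv_at_vertex[OF sunic_elems_inv[OF kG(1)]] unfolding inv_inv[OF kG(1)] .
    have B_inv: "invf ?B = at_vertex u (invf k')" by (rule inv_at_vertex[OF kG(2)])
    let ?Q = "g \<circ> ?A \<circ> invf g" and ?X = "at_vertex u (k \<circ> k' \<circ> invf k)"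
    have Q_in: "?Q \<in> G" using g A_in by (intro sunic_elems_comp sunic_elems_inv)
    define c where "c = ?Q \<circ> at_vertex u k"
    have "c = g \<circ> (?A \<circ> invf g \<circ> invf ?A)" unfolding c_def A_inv by (simp only: comp_assoc)
    then have c: "c \<in> N" using N(3)[OF assms(2) N(5)[OF N(4)[OF assms(2)] A_in]] by (simp only:)
    have "c \<circ> ?B \<circ> invf c = ?Q \<circ> ?X \<circ> invf ?Q"
    proof -
      have "invf c = ?A \<circ> invf ?Q"
        unfolding c_def inv_comp[OF Q_in at_vertex_in_K[OF that(1), THEN K_subset]]
          inv_at_vertex[OF kG(1)] ..
      then show ?thesis unfolding c_def at_vertex_comp by (simp only: comp_assoc)
    qed
    also have "\<dots> = ?X \<circ> (?Q \<circ> invf ?Q)"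
      unfolding moved_at_vertex_commute[OF g assms(3)] by (simp only: comp_assoc)
    also have "?Q \<circ> invf ?Q = id" using inv_apply(2)[OF Q_in] by (intro ext) (simp only: comp_apply id_apply)
    finally have "c \<circ> (?B \<circ> invf c \<circ> invf ?B) = at_vertex u (k \<circ> k' \<circ> invf k \<circ> invf k')"
      unfolding B_inv at_vertex_comp comp_id by (simp only: comp_assoc[symmetric])
    moreover have "c \<circ> (?B \<circ> invf c \<circ> invf ?B) \<in> N"
      by (rule N(3)[OF c N(5)[OF N(4)[OF c] B_in]])
    ultimately show ?thesis by (simp only:)
  qed
  from assms(4) show ?thesis unfolding derived_def
  proof (induction rule: generate.induct)
    case one
    have "at_vertex u id = id" by (rule ext) (auto simp: at_vertex_apply, metis append_take_drop_id)
    then show ?case using N(2) by (simp only: one_sunic)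
  next
    case (incl h)
    then show ?case using comm K_subset by auto
  next
    case (inv h)
    then obtain k k' where k: "k \<in> K" "k' \<in> K" and "h = k \<otimes>\<^bsub>sunic_group f\<^esub> k' \<otimes>\<^bsub>sunic_group f\<^esub>
      inv\<^bsub>sunic_group f\<^esub> k \<otimes>\<^bsub>sunic_group f\<^esub> inv\<^bsub>sunic_group f\<^esub> k'" by blast
    then have h: "h = k \<circ> k' \<circ> invf k \<circ> invf k'" using K_subset by simp
    have h_in: "h \<in> G" unfolding h using k K_subset sunic_elems_comp sunic_elems_inv by meson
    have "invf h = k' \<circ> k \<circ> invf k' \<circ> invf k"
      unfolding h by (rule inv_eqI) (rule ext, simp add: inv_apply[OF K_subset[OF k(1)]] inv_apply[OF K_subset[OF k(2)]])+
    then show ?case using comm[OF k(2,1)] m_inv_sunic[OF h_in] by (simp only:)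
  next
    case (eng h1 h2)
    then show ?case using N(3) by (simp only: mult_sunic at_vertex_comp)
  qed
qed

text \<open>An element for the tails is lifted one level by self-replication, with a swap when the
  first letters differ. The uncontrolled section lies off the path. One \<open>h\<close> serves
  every \<open>p\<close>, which arrives unchanged and not merely up to conjugation.\<close>

lemma at_vertex_transport:
  "length u = length v \<Longrightarrow> \<exists>h\<in>G. \<forall>p. h \<circ> at_vertex u p = at_vertex v p \<circ> h"
proof (induction u v rule: list_induct2)
  case Nil
  show ?case using sunic_elems.id by (intro bexI[of _ id]) (simp_all only: at_vertex.simps id_comp comp_id simp_thms)
next
  case (Cons x u y v)
  then obtain h where h: "h \<in> G" "\<And>p. h \<circ> at_vertex u p = at_vertex v p \<circ> h" by blast
  obtain h' where h': "h' \<in> G" "pair h' h \<in> G" using self_replicating[OF h(1)] by blast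
  then have h'': "pair h h' \<in> G" using pair_swap_in by blast
  note sw = swap_first_in
  consider "x = True" "y = True" | "x = False" "y = False" | "x = True" "y = False" | "x = False" "y = True"
    by (cases x; cases y) auto
  then show ?case
  proof cases
    case 1
    have "pair h' h \<circ> at_vertex (x # u) p = at_vertex (y # v) p \<circ> pair h' h" for p
      unfolding 1 at_vertex.simps pair_comp id_comp comp_id h(2) ..
    then show ?thesis using h'(2) by blast
  next
    case 2
    have "pair h h' \<circ> at_vertex (x # u) p = at_vertex (y # v) p \<circ> pair h h'" for p
      unfolding 2 at_vertex.simps pair_comp id_comp comp_id h(2) ..
    then show ?thesis using h'' by blast
  next
    case 3
    have "(swp \<circ> pair h' h) \<circ> at_vertex (x # u) p = at_vertex (y # v) p \<circ> (swp \<circ> pair h' h)" for p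
      unfolding 3 at_vertex.simps comp_assoc pair_comp id_comp comp_id h(2)
      unfolding comp_assoc[symmetric] swap_first_pair[symmetric]
      unfolding comp_assoc pair_comp id_comp comp_id ..
    then show ?thesis using sunic_elems_comp[OF sw h'(2)] by blast
  next
    case 4
    have "(swp \<circ> pair h h') \<circ> at_vertex (x # u) p = at_vertex (y # v) p \<circ> (swp \<circ> pair h h')" for p
      unfolding 4 at_vertex.simps comp_assoc pair_comp id_comp comp_id h(2)
      unfolding comp_assoc[symmetric] swap_first_pair[symmetric]
      unfolding comp_assoc pair_comp id_comp comp_id ..
    then show ?thesis using sunic_elems_comp[OF sw h''] by blast
  qed
qed

lemma level_product_in_normal:
  assumes "N \<lhd> sunic_group f" "g \<in> N" "g u \<noteq> u" "p \<in> level_product (length u) D"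
  shows "p \<in> N"
proof (rule level_product_subset[OF _ _ assms(4)])
  note N = normal_sunicD[OF assms(1)]
  show "at_vertex v d \<in> N" if v: "length v = length u" and d: "d \<in> D" for v d
  proof -
    obtain h where h: "h \<in> G" "h \<circ> at_vertex u d = at_vertex v d \<circ> h"
      using at_vertex_transport[OF v[symmetric]] by blast
    have "h \<circ> at_vertex u d \<circ> invf h = at_vertex v d"
      unfolding h(2) by (rule ext) (simp add: inv_apply[OF h(1)])
    then show ?thesis
      using N(5)[OF at_moved_vertex[OF assms(1-3) d] h(1)] by (simp only:)
  qed
  show "p \<circ> q \<in> N" if "p \<in> N" "q \<in> N" for p q by (rule N(3)[OF that])
qed

lemma normal_cover:
  assumes "N \<lhd> sunic_group f" "g \<in> N" "g \<noteq> id"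
  shows "\<exists>F. finite F \<and> (\<forall>h\<in>G. \<exists>e\<in>F. \<exists>p\<in>N. h = e \<circ> p)"
proof -
  obtain u where u: "g u \<noteq> u" using assms(3) by fastforce
  obtain F where F: "finite F \<and> (\<forall>h\<in>G. \<exists>e\<in>F. \<exists>p\<in>level_product (length u) D. h = e \<circ> p)"
    using level_product_cover[OF D_cover] by (rule exE)
  have "\<exists>e\<in>F. \<exists>p\<in>N. h = e \<circ> p" if h_in: "h \<in> G" for h
  proof -
    obtain e p where "e \<in> F" "p \<in> level_product (length u) D" "h = e \<circ> p"
      using bspec[OF F[THEN conjunct2] h_in] by (elim bexE)
    then show ?thesis using level_product_in_normal[OF assms(1,2) u] by (intro bexI)
  qed
  then show ?thesis using F by (intro exI[of _ F] conjI ballI) (elim conjE)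
qed

text \<open>If \<open>\<rho> b = b\<close> and \<open>\<omega> b\<close> is nontrivial, then \<open>t = a b\<close> satisfies \<open>\<psi>(t\<^sup>2) = (t\<^sup>-\<^sup>1, t)\<close>, so the powers
  of \<open>t\<close> reach every level.\<close>

lemma translation_power_in_normal:
  assumes "N \<lhd> sunic_group f" "g \<in> N" "g \<noteq> id" "b \<in> B" "\<omega> b = 1" "\<rho> b = b"
  shows "\<exists>k. (swp \<circ> \<beta> b) ^^ (2 ^ k) \<in> N"
proof -
  obtain u where u: "g u \<noteq> u" using assms(3) by fastforce
  let ?t = "swp \<circ> \<beta> b" and ?s = "\<beta> b \<circ> swp"
  \<comment> \<open>The fourth power lies in \<open>K\<close>, and a further 2-power exponent
    carries it into \<open>D\<close>.\<close>
  obtain e0 where e0: "(?t ^^ (2 ^ Suc (Suc 0))) ^^ (2 ^ e0) \<in> D"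
    using K_power_in_D[OF swap_act_pow4[OF assms(4)]] by blast
  define e where "e = Suc (Suc 0) + e0"
  have e: "?t ^^ (2 ^ e) \<in> D" using e0 unfolding funpow_mult e_def power_add .
  have s: "?s = swp \<circ> ?t \<circ> swp"
    by (simp only: comp_assoc[symmetric] swap_first_swap_first id_comp)
  have "?s ^^ (2 ^ e) = swp \<circ> ?t ^^ (2 ^ e) \<circ> swp"
    unfolding s by (rule funpow_conj[OF swap_first_swap_first swap_first_swap_first])
  then have e': "?s ^^ (2 ^ e) \<in> D" using D_rules(5)[OF e swap_first_in] by (simp only: inv_swap_first)
  have b: "\<beta> b = pair swp (\<beta> b)" using act_B_nonkernel[OF assms(5)] assms(6) by (simp only:)
  have sb: "swp \<circ> \<beta> b \<circ> swp = pair (\<beta> b) swp" by (subst b) (rule swap_conj_pair)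
  have tt: "?t \<circ> ?t = pair ?s ?t"
  proof -
    have "?t \<circ> ?t = (swp \<circ> \<beta> b \<circ> swp) \<circ> \<beta> b" by (simp only: comp_assoc)
    also have "\<dots> = pair (\<beta> b) swp \<circ> pair swp (\<beta> b)" using sb b by metis
    finally show ?thesis unfolding pair_comp .
  qed
  have ss: "?s \<circ> ?s = pair ?t ?s"
  proof -
    have "?s \<circ> ?s = \<beta> b \<circ> (swp \<circ> \<beta> b \<circ> swp)" by (simp only: comp_assoc)
    also have "\<dots> = pair swp (\<beta> b) \<circ> pair (\<beta> b) swp" using sb b by metis
    finally show ?thesis unfolding pair_comp .
  qed
  \<comment> \<open>\<open>?s\<close> is the inverse of \<open>?t\<close>. Both sections of either
    square are again \<open>?s\<close> or \<open>?t\<close>, so the two must be followed together;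
    each squaring descends one level.\<close>
  have "?t ^^ (2 ^ (n + e)) \<in> level_product n D \<and> ?s ^^ (2 ^ (n + e)) \<in> level_product n D" for n
  proof (induction n)
    case 0
    then show ?case using e e' by (simp only: add_0_left level_product.simps simp_thms)
  next
    case (Suc n)
    then show ?case
      unfolding add_Suc funpow_power2_Suc tt ss pair_funpow level_product.simps by blast
  qed
  then show ?thesis using level_product_in_normal[OF assms(1,2) u] by blast
qed

end

section \<open>Elements of infinite order\<close>

definition torsion_fun :: "('a \<Rightarrow> 'a) \<Rightarrow> bool" where
  "torsion_fun g \<longleftrightarrow> (\<exists>n>0. g ^^ n = id)"

lemma torsion_funI: "g ^^ n = id \<Longrightarrow> n > 0 \<Longrightarrow> torsion_fun g"
  unfolding torsion_fun_def by blast

lemma torsion_fun_conj: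
  assumes "h' \<circ> h = id" "h \<circ> h' = id" "torsion_fun g"
  shows "torsion_fun (h \<circ> g \<circ> h')"
proof -
  obtain n where n: "n > 0" "g ^^ n = id" using assms(3) unfolding torsion_fun_def by blast
  show ?thesis
    by (rule torsion_funI[OF _ n(1)]) (simp only: funpow_conj[OF assms(1,2)] n(2) comp_id assms(2))
qed

lemma torsion_fun_pair:
  assumes "torsion_fun g" "torsion_fun h"
  shows "torsion_fun (pair g h)"
proof -
  obtain i where i: "i > 0" "g ^^ i = id" using assms(1) unfolding torsion_fun_def by blast
  obtain j where j: "j > 0" "h ^^ j = id" using assms(2) unfolding torsion_fun_def by blast
  have "g ^^ (i * j) = id" unfolding funpow_mult[symmetric] i(2) id_funpow ..
  moreover have "h ^^ (i * j) = id"
    unfolding mult.commute[of i] funpow_mult[symmetric] j(2) id_funpow ..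
  ultimately have "pair g h ^^ (i * j) = id" by (simp only: pair_funpow pair_id)
  then show ?thesis by (rule torsion_funI) (simp add: i(1) j(1))
qed

lemma torsion_fun_square:
  assumes "torsion_fun (g \<circ> g)"
  shows "torsion_fun g"
proof -
  obtain n where n: "n > 0" "(g \<circ> g) ^^ n = id" using assms unfolding torsion_fun_def by blast
  have "g ^^ 2 = g \<circ> g" by (simp only: numeral_2_eq_2 funpow.simps comp_id)
  then have "g ^^ (2 * n) = id"
    unfolding funpow_mult[symmetric] using n(2) by (simp only:)
  then show ?thesis by (rule torsion_funI) (simp add: n(1))
qed

fun evens odds :: "'a list \<Rightarrow> 'a list" where
  "evens [] = []"
| "evens (x # xs) = x # odds xs"
| "odds [] = []"
| "odds (x # xs) = evens xs"

lemma evens_odds_append: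
  "evens (xs @ ys) = evens xs @ (if even (length xs) then evens ys else odds ys)"
  "odds (xs @ ys) = odds xs @ (if even (length xs) then odds ys else evens ys)"
  by (induction xs) auto

lemma length_filter_evens_odds:
  "length (filter P (evens xs)) + length (filter P (odds xs)) = length (filter P xs)"
  by (induction xs) auto

lemma set_evens_odds: "set (evens xs) \<union> set (odds xs) = set xs"
  by (induction xs) auto

text \<open>The second copy of an odd list starts at an odd position, so the even positions of the
  doubled list meet every letter exactly once, and likewise the odd ones.\<close>

lemma double_odd_list:
  assumes "odd (length xs)"
  shows "length (filter P (evens (xs @ xs))) = length (filter P xs)"
    and "length (filter P (odds (xs @ xs))) = length (filter P xs)"
    and "set (evens (xs @ xs)) = set xs" and "set (odds (xs @ xs)) = set xs"
  using assms length_filter_evens_odds[of P xs] set_evens_odds[of xs]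
  by (auto simp: evens_odds_append)

section \<open>Words in \<open>a\<close> and \<open>B\<close> and their sections\<close>

context sunic
begin

text \<open>Alternating words that begin with \<open>a\<close> and end in \<open>B\<close>. Letters
  may be trivial, so no reduced form has to be maintained.\<close>

fun word :: "(nat \<Rightarrow> bit) list \<Rightarrow> vertex \<Rightarrow> vertex" where
  "word [] = id"
| "word (x # xs) = swp \<circ> \<beta> x \<circ> word xs"

lemma word_append: "word (xs @ ys) = word xs \<circ> word ys"
  by (induction xs) (simp_all only: append.simps word.simps id_comp comp_assoc)

text \<open>These come from \<open>\<psi>(a x a) = (\<rho> x, \<omega> x)\<close> and
  \<open>\<psi>(y) = (\<omega> y, \<rho> y)\<close>. Words are read two letters at a time; the value
  on a single letter is a mere default.\<close>

fun sec0 sec1 :: "(nat \<Rightarrow> bit) list \<Rightarrow> vertex \<Rightarrow> vertex" where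
  "sec0 (x # y # xs) = \<beta> (\<rho> x) \<circ> (act_A (\<omega> y) \<circ> sec0 xs)"
| "sec0 _ = id"
| "sec1 (x # y # xs) = act_A (\<omega> x) \<circ> (\<beta> (\<rho> y) \<circ> sec1 xs)"
| "sec1 _ = id"

lemma word_even: "even (length xs) \<Longrightarrow> word xs = pair (sec0 xs) (sec1 xs)"
proof (induction xs rule: induct_list012)
  case 1
  show ?case by (simp only: word.simps sec0.simps sec1.simps pair_id)
next
  case (3 x y xs)
  have "word (x # y # xs) = (swp \<circ> \<beta> x \<circ> swp) \<circ> \<beta> y \<circ> word xs"
    by (simp only: word.simps comp_assoc)
  also have "\<dots> = pair (\<beta> (\<rho> x)) (act_A (\<omega> x)) \<circ> pair (act_A (\<omega> y)) (\<beta> (\<rho> y)) \<circ> word xs"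
    unfolding swap_conj_pair[of "act_A (\<omega> x)" "\<beta> (\<rho> x)", symmetric] act_B_pair[symmetric] ..
  also have "word xs = pair (sec0 xs) (sec1 xs)" using 3 by simp
  finally show ?case by (simp only: pair_comp sec0.simps sec1.simps comp_assoc)
qed simp

text \<open>\<open>k\<close> counts the occurrences of \<open>a\<close>. The additional letter in
  front allows the word to start in \<open>B\<close>.\<close>

definition short :: "nat \<Rightarrow> (vertex \<Rightarrow> vertex) \<Rightarrow> bool" where
  "short k g \<longleftrightarrow> (\<exists>x\<in>B. \<exists>xs. set xs \<subseteq> B \<and> length xs = k \<and> g = \<beta> x \<circ> word xs)"

lemma short_id: "short 0 id"
  unfolding short_def
  by (intro bexI[of _ "\<lambda>_. 0"] exI[of _ "[]"]) (simp_all add: sunic_B_zero)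

lemma short_act_B:
  assumes "short k g" "y \<in> B" shows "short k (\<beta> y \<circ> g)"
proof -
  obtain x xs where g: "x \<in> B" "set xs \<subseteq> B" "length xs = k" "g = \<beta> x \<circ> word xs"
    using assms(1) unfolding short_def by blast
  have "\<beta> y \<circ> g = \<beta> (\<lambda>i. y i + x i) \<circ> word xs"
    unfolding g(4) act_B_comp[symmetric] by (simp only: comp_assoc)
  then show ?thesis
    unfolding short_def using g sunic_B_add[OF assms(2) g(1)] by blast
qed

lemma short_swap:
  assumes "short k g" shows "short (Suc k) (swp \<circ> g)"
proof -
  obtain x xs where g: "x \<in> B" "set xs \<subseteq> B" "length xs = k" "g = \<beta> x \<circ> word xs"
    using assms unfolding short_def by blast
  have "swp \<circ> g = \<beta> (\<lambda>_. 0) \<circ> word (x # xs)"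
    unfolding g(4) act_B_zero by (simp only: word.simps id_comp comp_assoc)
  moreover have "set (x # xs) \<subseteq> B" "length (x # xs) = Suc k" using g by auto
  ultimately show ?thesis unfolding short_def using sunic_B_zero by blast
qed

lemma short_act_A:
  "short k g \<Longrightarrow> short (if e = 1 then Suc k else k) (act_A e \<circ> g)"
  using short_swap by (cases e) (simp_all only: act_A_simps id_comp if_True if_False zero_neq_one refl)

abbreviation "weight xs \<equiv> length (filter (\<lambda>x. \<omega> x = 1) xs)"

text \<open>Every \<open>a\<close> in a section comes from a letter with nontrivial
  \<open>\<omega>\<close>: at 0 from the odd positions, at 1 from the even ones, counted from zero.
  Letters of the kernel are lost, which makes the sections shorter.\<close>

lemma short_sec:
  "short (weight (odds xs)) (sec0 xs) \<and> short (weight (evens xs)) (sec1 xs)"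
  if "even (length xs)"
  using that
proof (induction xs rule: induct_list012)
  case 1
  show ?case using short_id by (simp only: sec0.simps sec1.simps evens.simps odds.simps filter.simps list.size simp_thms)
next
  case (3 x y xs)
  then have IH: "short (weight (odds xs)) (sec0 xs)" "short (weight (evens xs)) (sec1 xs)" by auto
  have 0: "weight (odds (x # y # xs)) = (if \<omega> y = 1 then Suc (weight (odds xs)) else weight (odds xs))"
    and 1: "weight (evens (x # y # xs)) = (if \<omega> x = 1 then Suc (weight (evens xs)) else weight (evens xs))"
    by simp_all
  show ?case
    unfolding 0 1 sec0.simps sec1.simps
    by (intro conjI short_act_B short_act_A IH sunic_rho_in_B)
qed simp

text \<open>Conjugation moves the letter in front to the end, where it merges with the last letter
  and leaves an alternating word of the same length. Without any \<open>a\<close> the element is an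
  involution.\<close>

lemma short_torsion:
  assumes "\<And>xs. set xs \<subseteq> B \<Longrightarrow> length xs = k \<Longrightarrow> torsion_fun (word xs)" "short k g"
  shows "torsion_fun g"
proof -
  obtain x xs where g: "x \<in> B" "set xs \<subseteq> B" "length xs = k" "g = \<beta> x \<circ> word xs"
    using assms(2) unfolding short_def by blast
  show ?thesis
  proof (cases xs rule: rev_cases)
    case Nil
    have "g = \<beta> x" unfolding g(4) Nil by (simp only: word.simps comp_id)
    then have "g \<circ> g = id" by (simp only: act_B_act_B)
    then have "g ^^ 2 = id" by (simp only: numeral_2_eq_2 funpow.simps comp_id)
    then show ?thesis by (rule torsion_funI) simp
  next
    case (snoc ys y)
    let ?z = "\<lambda>i. y i + x i"
    have y: "y \<in> B" "set ys \<subseteq> B" using g(2) snoc by auto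
    have "?z \<in> B" using y(1) g(1) sunic_B_add by blast
    then have "torsion_fun (word (ys @ [?z]))"
      using assms(1)[of "ys @ [?z]"] y g(3) snoc by simp
    then have "torsion_fun (\<beta> x \<circ> word (ys @ [?z]) \<circ> \<beta> x)"
      by (rule torsion_fun_conj[OF act_B_act_B act_B_act_B])
    also have "\<beta> x \<circ> word (ys @ [?z]) \<circ> \<beta> x = g"
      unfolding g(4) snoc word_append word.simps act_B_comp[symmetric] comp_assoc comp_id id_comp act_B_act_B ..
    finally show ?thesis .
  qed
qed

text \<open>No letter is lost here, so both sections are alternating words again. The one at 0
  begins in \<open>B\<close> and ends with \<open>a\<close>, whence the conjugation.\<close>

lemma sec_all_nonkernel:
  "even (length xs) \<Longrightarrow> \<forall>x\<in>set xs. \<omega> x = 1 \<Longrightarrow>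
    sec0 xs = swp \<circ> word (map \<rho> (evens xs)) \<circ> swp \<and> sec1 xs = word (map \<rho> (odds xs))"
proof (induction xs rule: induct_list012)
  case 1
  show ?case by (simp only: sec0.simps sec1.simps evens.simps odds.simps list.map word.simps comp_id
    swap_first_swap_first simp_thms)
next
  case (3 x y xs)
  then have IH: "sec0 xs = swp \<circ> word (map \<rho> (evens xs)) \<circ> swp" "sec1 xs = word (map \<rho> (odds xs))"
    and w: "\<omega> x = 1" "\<omega> y = 1" by auto
  have swp: "swp \<circ> (swp \<circ> h) = h" for h :: "vertex \<Rightarrow> vertex"
    by (simp only: comp_assoc[symmetric] swap_first_swap_first id_comp)
  show ?case
    unfolding sec0.simps sec1.simps IH w act_A_simps evens.simps odds.simps list.map word.simps comp_assoc swp
    by (intro conjI refl)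
qed simp

text \<open>The two sections of a word of even length in \<open>a\<close> and \<open>B\<close> are half as long; a word of odd length
  is squared first. Then both sections are shorter than the word if one of its letters lies in the
  kernel of \<open>\<omega>\<close>; otherwise they have the same length, and their letters are one step further along
  the orbits of \<open>\<rho>\<close>.\<close>

lemma word_torsion:
  assumes hits: "\<And>x. x \<in> B \<Longrightarrow> \<exists>j. \<omega> ((\<rho> ^^ j) x) = 0"
  shows "set xs \<subseteq> B \<Longrightarrow> torsion_fun (word xs)"
proof (induction "length xs" arbitrary: xs rule: less_induct)
  case less
  have IH: "torsion_fun g" if "short k g" "k < length xs" for k g
    using short_torsion[OF _ that(1)] less(1) that(2) by simp
  show ?case
  proof (cases "even (length xs)")
    case even: True
    show ?thesis
    proof (cases "xs = []")
      case True
      have "(word xs) ^^ 1 = id" unfolding True by (simp only: word.simps id_funpow)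
      then show ?thesis by (rule torsion_funI) simp
    next
      case False
      have "length (evens ys) = (length ys + 1) div 2 \<and> length (odds ys) = length ys div 2"
        for ys :: "(nat \<Rightarrow> bit) list"
        by (induction ys) auto
      then have "length (evens xs) < length xs" "length (odds xs) < length xs"
        using False even by (auto elim!: evenE)
      then have "weight (evens xs) < length xs" "weight (odds xs) < length xs"
        by (meson le_less_trans length_filter_le)+
      then show ?thesis
        using IH short_sec[OF even] torsion_fun_pair word_even[OF even] by metis
    qed
  next
    case odd: False
    \<comment> \<open>The length is now fixed, and the induction runs on the number \<open>j\<close>
      of steps that some letter \<open>x\<close> needs to reach the kernel. Doubling an odd word
      puts \<open>\<rho> x\<close> into both sections, so \<open>j\<close> drops in each of
      them.\<close>
    have *: "torsion_fun (word ys)"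
      if "set ys \<subseteq> B" "length ys = length xs" "x \<in> set ys" "\<omega> ((\<rho> ^^ j) x) = 0" for ys x j
      using that
    proof (induction j arbitrary: ys x)
      have even2: "even (length (ys @ ys))" for ys :: "(nat \<Rightarrow> bit) list" by simp
      have sq: "torsion_fun (word ys)"
        if "torsion_fun (sec0 (ys @ ys))" "torsion_fun (sec1 (ys @ ys))" for ys
      proof (rule torsion_fun_square)
        show "torsion_fun (word ys \<circ> word ys)"
          unfolding word_append[symmetric] word_even[OF even2] by (rule torsion_fun_pair[OF that])
      qed
      have kernel: "torsion_fun (word ys)"
        if "set ys \<subseteq> B" "length ys = length xs" "x \<in> set ys" "\<omega> x = 0" for ys x
      proof -
        have "weight ys < length xs"
          using that length_filter_less[of x ys "\<lambda>x. \<omega> x = 1"] by simp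
        moreover have "weight (evens (ys @ ys)) = weight ys" "weight (odds (ys @ ys)) = weight ys"
          using double_odd_list odd that(2) by metis+
        ultimately show ?thesis
          using sq IH short_sec[OF even2[of ys]] by metis
      qed
      {
        case 0
        then show ?case using kernel[of ys x] by (simp only: funpow_0)
      next
        case (Suc j)
        show ?case
        proof (cases "\<exists>y\<in>set ys. \<omega> y = 0")
          case True
          then show ?thesis using kernel Suc.prems by blast
        next
          case False
          then have "\<forall>y\<in>set (ys @ ys). \<omega> y = 1" using bit_cases by auto
          note sec = sec_all_nonkernel[OF even2 this]
          have ev: "set (evens (ys @ ys)) = set ys" and od: "set (odds (ys @ ys)) = set ys"
            using double_odd_list(3,4)[of ys] odd Suc.prems(2) by simp_all
          have len: "length (evens (ys @ ys)) = length ys" "length (odds (ys @ ys)) = length ys"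
            using double_odd_list(1,2)[of ys "\<lambda>_. True"] odd Suc.prems(2) by simp_all
          have hit: "\<omega> ((\<rho> ^^ j) (\<rho> x)) = 0"
            using Suc.prems(4) by (simp add: funpow_swap1)
          have "torsion_fun (word (map \<rho> (evens (ys @ ys))))"
            using Suc.IH[OF _ _ _ hit] Suc.prems ev len by (simp add: image_subset_iff sunic_rho_in_B)
          moreover have "torsion_fun (word (map \<rho> (odds (ys @ ys))))"
            using Suc.IH[OF _ _ _ hit] Suc.prems od len by (simp add: image_subset_iff sunic_rho_in_B)
          ultimately show ?thesis
            using sq sec torsion_fun_conj[OF swap_first_swap_first swap_first_swap_first] by metis
        qed
      }
    qed
    obtain x where x: "x \<in> set xs" using odd by (cases xs) auto
    then have "x \<in> B" using less(2) by blast
    then show ?thesis using *[OF less(2) refl x] hits by blast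
  qed
qed

lemma torsion_sunic_group:
  assumes hits: "\<And>x. x \<in> B \<Longrightarrow> \<exists>j. \<omega> ((\<rho> ^^ j) x) = 0"
  shows "torsion_group (sunic_group f)"
proof -
  have "\<exists>k. short k g" if "g \<in> G" for g
    using that
  proof (induction rule: sunic_elems.induct)
    case id show ?case using short_id by blast
  next
    case (swap g) then show ?case using short_swap by blast
  next
    case (act x g) then show ?case using short_act_B by blast
  qed
  then have "torsion_fun g" if "g \<in> G" for g
    using short_torsion word_torsion[OF hits] that by blast
  then show ?thesis
    unfolding torsion_group_def torsion_fun_def carrier_sunic pow_sunic one_sunic by blast
qed

lemma rho_pow_add: "(\<rho> ^^ j) (\<lambda>i. x i + y i) = (\<lambda>i. (\<rho> ^^ j) x i + (\<rho> ^^ j) y i)"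
  by (induction j) (simp_all only: funpow_0 funpow.simps comp_apply sunic_rho_add id_apply)

text \<open>Some orbit of \<open>\<rho>\<close> avoids the kernel, so \<open>\<omega>\<close> is 1
  all along it. Then \<open>\<omega>\<close> vanishes along the orbit of
  \<open>b + \<rho> b\<close>, which is zero by \<open>omega_rho_faithful\<close>.\<close>

lemma nontorsion_fixed_point:
  assumes "\<not> torsion_group (sunic_group f)"
  obtains b where "b \<in> B" "\<omega> b = 1" "\<rho> b = b"
proof -
  obtain b where b: "b \<in> B" "\<And>j. \<omega> ((\<rho> ^^ j) b) \<noteq> 0"
    using assms torsion_sunic_group by blast
  then have b1: "\<omega> ((\<rho> ^^ j) b) = 1" for j using bit_cases by blast
  have "(\<lambda>i. b i + \<rho> b i) = (\<lambda>_. 0)"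
  proof (rule omega_rho_faithful)
    show "(\<lambda>i. b i + \<rho> b i) \<in> B" by (intro sunic_B_add b(1) sunic_rho_in_B)
    fix j
    have "\<omega> ((\<rho> ^^ j) (\<rho> b)) = 1" using b1[of "Suc j"] by (simp add: funpow_swap1)
    then show "\<omega> ((\<rho> ^^ j) (\<lambda>i. b i + \<rho> b i)) = 0"
      unfolding rho_pow_add sunic_omega_add b1 by simp
  qed
  then have "b i + \<rho> b i = 0" for i by (rule fun_cong)
  then have "\<rho> b i = b i" for i
    using bit_cases[of "b i"] bit_cases[of "\<rho> b i"] by (metis add_0 one_neq_zero add.right_neutral)
  then have "\<rho> b = b" by (rule ext)
  then show thesis using that b(1) b1[of 0] by simp
qed

end

section \<open>The orbit of the fixed end of \<open>B\<close>\<close>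

text \<open>\<open>gray n i\<close> is the image of the vertex \<open>1\<^sup>n\<close> under the first \<open>i\<close> letters, read from the right,
  of \<open>\<dots> a b a b a\<close>. In this numbering every element of \<open>G\<close> acts on a half-line: \<open>a\<close> exchanges the
  indices \<open>2 k\<close> and \<open>2 k + 1\<close>, and elements of \<open>B\<close> fix or exchange \<open>2 k + 1\<close> and \<open>2 k + 2\<close>.\<close>

fun gray :: "nat \<Rightarrow> nat \<Rightarrow> vertex" where
  "gray 0 i = []"
| "gray (Suc n) i = even (i + i div 2) # gray n (i div 2)"

lemma swap_first_gray: "swap_first (gray n i) = gray n (if even i then i + 1 else i - 1)"
proof (cases n)
  case (Suc k)
  show ?thesis
  proof (cases "even i")
    case True
    then obtain h where "i = 2 * h" by (elim evenE)
    then show ?thesis using Suc by simp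
  next
    case False
    then obtain h where "i = 2 * h + 1" by (elim oddE)
    then show ?thesis using Suc by simp
  qed
qed simp

definition gray_reflect :: "nat \<Rightarrow> nat" where
  "gray_reflect i = (if i = 0 then 0 else if odd i then i + 1 else i - 1)"

text \<open>The first letter is 1 exactly when \<open>i\<close> is 0 or 3 modulo 4. The reflection
  then joins \<open>4 q + 3\<close> to \<open>4 q + 4\<close>, whose halves \<open>2 q + 1\<close>
  and \<open>2 q + 2\<close> are again joined by the reflection; 0 stays fixed. This matches the
  second component of \<open>\<psi>(b) = (a, b)\<close>.\<close>

lemma gray_reflect_True:
  assumes "even (i + i div 2)"
  shows "gray (Suc n) (gray_reflect i) = True # gray n (gray_reflect (i div 2))"
proof (cases "even i")
  case True
  then obtain h where i: "i = 2 * h" by (elim evenE)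
  have "even h" using assms i by simp
  then obtain q where "h = 2 * q" by (elim evenE)
  then show ?thesis using i by (cases q) (auto simp: gray_reflect_def)
next
  case False
  then obtain h where i: "i = 2 * h + 1" by (elim oddE)
  have "odd h" using assms i by simp
  then show ?thesis using i by (auto simp: gray_reflect_def elim!: oddE)
qed

text \<open>Here the reflection joins \<open>4 q + 1\<close> to \<open>4 q + 2\<close>, whose halves
  \<open>2 q\<close> and \<open>2 q + 1\<close> are exchanged by \<open>a\<close>.\<close>

lemma gray_reflect_False:
  assumes "odd (i + i div 2)"
  shows "gray (Suc n) (gray_reflect i) = False # swap_first (gray n (i div 2))"
proof (cases "even i")
  case True
  then obtain h where i: "i = 2 * h" by (elim evenE)
  have "odd h" using assms i by simp
  then obtain q where "h = 2 * q + 1" by (elim oddE)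
  then show ?thesis using i by (auto simp: gray_reflect_def swap_first_gray)
next
  case False
  then obtain h where i: "i = 2 * h + 1" by (elim oddE)
  have "even h" using assms i by simp
  then show ?thesis using i by (auto simp: gray_reflect_def swap_first_gray elim!: evenE)
qed

lemma act_B_gray: "act_B f x (gray n i) = gray n i \<or> act_B f x (gray n i) = gray n (gray_reflect i)"
proof (induction n arbitrary: x i)
  case (Suc n)
  show ?case
  proof (cases "even (i + i div 2)")
    case True
    then have gray: "gray (Suc n) i = True # gray n (i div 2)" by simp
    show ?thesis
      using Suc[of "sunic_rho f x" "i div 2"] unfolding gray gray_reflect_True[OF True] act_B.simps by simp
  next
    case False
    then have gray: "gray (Suc n) i = False # gray n (i div 2)" by simp
    show ?thesis
      using bit_cases[of "sunic_omega f x"] unfolding gray gray_reflect_False[OF False] act_B.simps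
      by auto
  qed
qed simp

lemma act_B_fixed_gray:
  assumes "sunic_omega f b = 1" "sunic_rho f b = b"
  shows "act_B f b (gray n i) = gray n (gray_reflect i)"
proof (induction n arbitrary: i)
  case (Suc n)
  show ?case
  proof (cases "even (i + i div 2)")
    case True
    then have gray: "gray (Suc n) i = True # gray n (i div 2)" by simp
    show ?thesis unfolding gray gray_reflect_True[OF True] act_B.simps assms(2) Suc ..
  next
    case False
    then have gray: "gray (Suc n) i = False # gray n (i div 2)" by simp
    show ?thesis unfolding gray gray_reflect_False[OF False] act_B.simps assms(1) act_A_simps ..
  qed
qed simp

text \<open>\<open>gray\<close> is the reflected Gray code with complemented bits, lowest bit first.
  The tail determines \<open>i div 2\<close>, and the first letter then gives the parity of
  \<open>i\<close>.\<close>

lemma gray_inj: "gray n i = gray n j \<Longrightarrow> i < 2 ^ n \<Longrightarrow> j < 2 ^ n \<Longrightarrow> i = j"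
proof (induction n arbitrary: i j)
  case (Suc n)
  then have "i div 2 = j div 2" by (intro Suc.IH) auto
  moreover have "even (i + i div 2) = even (j + j div 2)" using Suc.prems(1) by simp
  ultimately have "even i = even j" by (metis even_add)
  then show ?case using \<open>i div 2 = j div 2\<close> by (metis div_mult_mod_eq odd_iff_mod_2_eq_one even_iff_mod_2_eq_zero)
qed simp

section \<open>Primitive actions on cosets\<close>

context group
begin

lemma lcosetsI: "x \<in> carrier G \<Longrightarrow> x <# M \<in> lcosets M"
  by (auto simp: LCOSETS_def)

lemma lcosetsE:
  assumes "C \<in> lcosets M"
  obtains x where "x \<in> carrier G" "C = x <# M"
  using assms by (auto simp: LCOSETS_def)

lemma coset_action_coset:
  assumes "subgroup M G" "g \<in> carrier G" "x \<in> carrier G"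
  shows "coset_action G M g (x <# M) = (g \<otimes> x) <# M"
  using assms lcosetsI[of x M] by (simp add: coset_action_def lcos_m_assoc subgroup.subset)

lemma coset_action_closed:
  assumes "subgroup M G" "g \<in> carrier G" "C \<in> lcosets M"
  shows "coset_action G M g C \<in> lcosets M"
proof -
  obtain x where "x \<in> carrier G" "C = x <# M" using assms(3) by (rule lcosetsE)
  then show ?thesis using assms lcosetsI by (simp add: coset_action_coset)
qed

lemma coset_action_comp:
  assumes "subgroup M G" "g \<in> carrier G" "h \<in> carrier G" "C \<in> lcosets M"
  shows "coset_action G M (g \<otimes> h) C = coset_action G M g (coset_action G M h C)"
proof -
  obtain x where "x \<in> carrier G" "C = x <# M" using assms(4) by (rule lcosetsE)
  then show ?thesis using assms by (simp add: coset_action_coset m_assoc)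
qed

lemma coset_action_one:
  assumes "subgroup M G" "C \<in> lcosets M"
  shows "coset_action G M \<one> C = C"
proof -
  obtain x where "x \<in> carrier G" "C = x <# M" using assms(2) by (rule lcosetsE)
  then show ?thesis using assms by (simp add: coset_action_coset)
qed

lemma transitive_coset_action:
  assumes M: "subgroup M G"
  shows "transitive_action G (lcosets M) (coset_action G M)"
proof -
  let ?E = "lcosets M" and ?\<phi> = "coset_action G M"
  have ext: "?\<phi> g \<in> extensional ?E" for g by (simp add: coset_action_def)
  have bij: "?\<phi> g \<in> Bij ?E" if g: "g \<in> carrier G" for g
  proof -
    have "bij_betw (?\<phi> g) ?E ?E"
    proof (rule bij_betw_byWitness[where f' = "?\<phi> (inv g)"])
      show "\<forall>C\<in>?E. ?\<phi> (inv g) (?\<phi> g C) = C" "\<forall>C\<in>?E. ?\<phi> g (?\<phi> (inv g) C) = C"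
        using g by (simp_all add: coset_action_comp[OF M, symmetric] coset_action_one[OF M])
      show "?\<phi> g ` ?E \<subseteq> ?E" "?\<phi> (inv g) ` ?E \<subseteq> ?E"
        using g coset_action_closed[OF M] by auto
    qed
    then show ?thesis using ext by (simp add: Bij_def)
  qed
  have "?\<phi> \<in> hom G (BijGroup ?E)"
  proof (rule homI)
    fix g h assume gh: "g \<in> carrier G" "h \<in> carrier G"
    show "?\<phi> (g \<otimes> h) = ?\<phi> g \<otimes>\<^bsub>BijGroup ?E\<^esub> ?\<phi> h"
    proof (rule extensionalityI[OF ext])
      have *: "?\<phi> g \<otimes>\<^bsub>BijGroup ?E\<^esub> ?\<phi> h = compose ?E (?\<phi> g) (?\<phi> h)"
        using gh bij by (simp add: BijGroup_def)
      then show "?\<phi> g \<otimes>\<^bsub>BijGroup ?E\<^esub> ?\<phi> h \<in> extensional ?E" by simp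
      show "?\<phi> (g \<otimes> h) C = (?\<phi> g \<otimes>\<^bsub>BijGroup ?E\<^esub> ?\<phi> h) C" if "C \<in> ?E" for C
        using that coset_action_comp[OF M gh] * by (simp add: compose_eq)
    qed
  qed (simp add: BijGroup_def bij)
  then have "group_action G ?E ?\<phi>"
    by (simp add: group_action_def group_hom_def group_hom_axioms_def group_axioms group_BijGroup)
  moreover have "\<exists>g\<in>carrier G. ?\<phi> g C = C'" if CC: "C \<in> ?E" "C' \<in> ?E" for C C'
  proof -
    obtain x where x: "x \<in> carrier G" "C = x <# M" using CC(1) by (rule lcosetsE)
    obtain y where y: "y \<in> carrier G" "C' = y <# M" using CC(2) by (rule lcosetsE)
    have "?\<phi> (y \<otimes> inv x) C = C'"
      using x y M by (simp add: coset_action_coset m_assoc)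
    then show ?thesis using x y by blast
  qed
  ultimately show ?thesis
    by (simp add: transitive_action_def transitive_action_axioms_def)
qed

lemma coset_eq_iff:
  assumes "subgroup M G" "x \<in> carrier G" "y \<in> carrier G"
  shows "x <# M = y <# M \<longleftrightarrow> inv x \<otimes> y \<in> M"
proof
  assume "x <# M = y <# M"
  then have "y \<in> x <# M" using lcos_self[OF assms(3,1)] by simp
  then show "inv x \<otimes> y \<in> M"
    by (rule subgroup.lcos_module_imp[OF assms(1) is_group assms(2)])
next
  assume "inv x \<otimes> y \<in> M"
  then have "x \<otimes> (inv x \<otimes> y) \<in> x <# M" by (auto simp: l_coset_def)
  then have "y \<in> x <# M" using assms by (simp add: m_assoc[symmetric])
  then show "x <# M = y <# M" by (rule l_repr_independence[OF _ assms(2,1)])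
qed

text \<open>An invariant equivalence relation is determined by the class of the coset
  \<open>M\<close>. The elements that carry \<open>M\<close> into this class form a subgroup
  \<open>H\<close> between \<open>M\<close> and the group, so maximality leaves only the two trivial
  relations.\<close>

lemma primitive_coset_action:
  assumes "maximal_subgroup M G"
  shows "primitive_action G (lcosets M) (coset_action G M)"
proof -
  have M: "subgroup M G" and max: "\<And>H. subgroup H G \<Longrightarrow> M \<subseteq> H \<Longrightarrow> H = M \<or> H = carrier G"
    using assms by (auto simp: maximal_subgroup_def)
  have "r = Id_on (lcosets M) \<or> r = (lcosets M) \<times> (lcosets M)"
    if r: "equiv (lcosets M) r"
      and inv_r: "\<And>g C C'. g \<in> carrier G \<Longrightarrow> (C, C') \<in> r \<Longrightarrow> (coset_action G M g C, coset_action G M g C') \<in> r"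
    for r
  proof -
    have r_sub: "r \<subseteq> (lcosets M) \<times> (lcosets M)" and r_refl: "\<And>C. C \<in> lcosets M \<Longrightarrow> (C, C) \<in> r"
      and r_sym: "sym r" and r_trans: "trans r"
      using r by (auto simp: equiv_def refl_on_def)
    define H where "H = {g \<in> carrier G. (\<one> <# M, g <# M) \<in> r}"
    have shift: "((g \<otimes> x) <# M, (g \<otimes> y) <# M) \<in> r"
      if "(x <# M, y <# M) \<in> r" "g \<in> carrier G" "x \<in> carrier G" "y \<in> carrier G" for g x y
      using inv_r[OF that(2,1)] that M by (simp add: coset_action_coset)
    have r_iff: "(x <# M, y <# M) \<in> r \<longleftrightarrow> inv x \<otimes> y \<in> H" if xy: "x \<in> carrier G" "y \<in> carrier G" for x y
    proof
      assume "(x <# M, y <# M) \<in> r"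
      from shift[OF this inv_closed[OF xy(1)] xy] show "inv x \<otimes> y \<in> H"
        using xy by (simp add: H_def)
    next
      assume "inv x \<otimes> y \<in> H"
      then have "(\<one> <# M, (inv x \<otimes> y) <# M) \<in> r" by (simp add: H_def)
      from shift[OF this xy(1)] show "(x <# M, y <# M) \<in> r"
        using xy by (simp add: m_assoc[symmetric])
    qed
    have "subgroup H G"
    proof (rule subgroupI)
      show "H \<subseteq> carrier G" by (auto simp: H_def)
      have "\<one> \<in> H" by (simp add: H_def r_refl lcosetsI)
      then show "H \<noteq> {}" by blast
    next
      fix g assume g: "g \<in> H"
      then have "(g <# M, \<one> <# M) \<in> r" and gG: "g \<in> carrier G"
        using r_sym by (auto simp: H_def sym_def)
      then show "inv g \<in> H" using r_iff[of g \<one>] by simp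
    next
      fix g h assume g: "g \<in> H" and h: "h \<in> H"
      then have gh: "g \<in> carrier G" "h \<in> carrier G" by (auto simp: H_def)
      have "(\<one> <# M, g <# M) \<in> r" using g by (simp add: H_def)
      moreover have "(g <# M, (g \<otimes> h) <# M) \<in> r"
        using r_iff[of g "g \<otimes> h"] gh h by (simp add: m_assoc[symmetric])
      ultimately have "(\<one> <# M, (g \<otimes> h) <# M) \<in> r" using r_trans by (meson transD)
      then show "g \<otimes> h \<in> H" using gh by (simp add: H_def)
    qed
    moreover have "M \<subseteq> H"
    proof
      fix g assume g: "g \<in> M"
      then have "g \<in> carrier G" using M subgroup.subset by blast
      moreover have "\<one> <# M = g <# M"
        using coset_eq_iff[OF M one_closed, of g] g \<open>g \<in> carrier G\<close> by simp
      ultimately show "g \<in> H" using r_refl lcosetsI[of g M] by (simp add: H_def)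
    qed
    ultimately have "H = M \<or> H = carrier G" by (rule max)
    then show ?thesis
    proof
      assume H: "H = M"
      have eq: "C = C'" if CC: "(C, C') \<in> r" for C C'
      proof -
        have "C \<in> lcosets M" "C' \<in> lcosets M" using CC r_sub by auto
        then obtain x y where x: "x \<in> carrier G" "C = x <# M" and y: "y \<in> carrier G" "C' = y <# M"
          by (elim lcosetsE) blast
        have "inv x \<otimes> y \<in> M" using CC r_iff[OF x(1) y(1)] unfolding x(2) y(2) H by simp
        then show ?thesis unfolding x(2) y(2) using coset_eq_iff[OF M x(1) y(1)] by simp
      qed
      have "r = Id_on (lcosets M)"
      proof (rule subset_antisym)
        show "r \<subseteq> Id_on (lcosets M)" using eq r_sub by auto
        show "Id_on (lcosets M) \<subseteq> r" using r_refl by auto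
      qed
      then show ?thesis ..
    next
      assume H: "H = carrier G"
      have all: "(C, C') \<in> r" if CC: "C \<in> lcosets M" "C' \<in> lcosets M" for C C'
      proof -
        obtain x where x: "x \<in> carrier G" "C = x <# M" using CC(1) by (rule lcosetsE)
        obtain y where y: "y \<in> carrier G" "C' = y <# M" using CC(2) by (rule lcosetsE)
        show ?thesis using r_iff[OF x(1) y(1)] x(1) y(1) unfolding x(2) y(2) H by simp
      qed
      then have "(lcosets M) \<times> (lcosets M) \<subseteq> r" by blast
      then have "r = (lcosets M) \<times> (lcosets M)" using r_sub by (rule subset_antisym[rotated])
      then show ?thesis ..
    qed
  qed
  then show ?thesis
    using transitive_coset_action[OF M]
    unfolding primitive_action_def primitive_action_axioms_def by blast
qed

text \<open>The kernel of the action is normal, and it fixes the coset \<open>M\<close>, so it is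
  contained in \<open>M\<close>.\<close>

lemma faithful_coset_action:
  assumes M: "subgroup M G" and core: "\<And>N. N \<lhd> G \<Longrightarrow> N \<subseteq> M \<Longrightarrow> N = {\<one>}"
  shows "faithful_action G (lcosets M) (coset_action G M)"
proof -
  let ?\<phi> = "coset_action G M"
  interpret transitive_action G "lcosets M" ?\<phi> by (rule transitive_coset_action[OF M])
  define N where "N = {g \<in> carrier G. \<forall>C\<in>lcosets M. ?\<phi> g C = C}"
  have "subgroup N G"
  proof (rule subgroupI)
    show "N \<subseteq> carrier G" by (auto simp: N_def)
    show "N \<noteq> {}" using coset_action_one[OF M] by (auto simp: N_def)
  next
    fix g assume g: "g \<in> N"
    then have gG: "g \<in> carrier G" by (simp add: N_def)
    have "?\<phi> (inv g) C = C" if C: "C \<in> lcosets M" for C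
    proof -
      have "?\<phi> (inv g) C = ?\<phi> (inv g) (?\<phi> g C)" using g C by (simp add: N_def)
      also have "\<dots> = C"
        using gG C by (simp add: coset_action_comp[OF M, symmetric] coset_action_one[OF M])
      finally show ?thesis .
    qed
    then show "inv g \<in> N" using gG by (simp add: N_def)
  next
    fix g h assume "g \<in> N" "h \<in> N"
    then show "g \<otimes> h \<in> N" by (simp add: N_def coset_action_comp[OF M])
  qed
  moreover have "x \<otimes> g \<otimes> inv x \<in> N" if x: "x \<in> carrier G" and g: "g \<in> N" for x g
  proof -
    have gG: "g \<in> carrier G" using g by (simp add: N_def)
    have "?\<phi> (x \<otimes> g \<otimes> inv x) C = C" if C: "C \<in> lcosets M" for C
    proof -
      have C': "?\<phi> (inv x) C \<in> lcosets M" using x C by (intro coset_action_closed[OF M]) auto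
      have "?\<phi> (x \<otimes> g \<otimes> inv x) C = ?\<phi> x (?\<phi> g (?\<phi> (inv x) C))"
        using x gG C C' by (simp add: coset_action_comp[OF M])
      also have "\<dots> = ?\<phi> x (?\<phi> (inv x) C)" using g C' by (simp add: N_def)
      also have "\<dots> = C"
        using x C by (simp add: coset_action_comp[OF M, symmetric] coset_action_one[OF M])
      finally show ?thesis .
    qed
    then show ?thesis using x gG by (simp add: N_def)
  qed
  ultimately have "N \<lhd> G" by (intro normal_invI) auto
  moreover have "N \<subseteq> M"
  proof
    fix g assume g: "g \<in> N"
    then have gG: "g \<in> carrier G" by (simp add: N_def)
    have "?\<phi> g (\<one> <# M) = \<one> <# M" using g lcosetsI[of \<one> M] by (simp add: N_def)
    then have "\<one> <# M = g <# M" using gG by (simp add: coset_action_coset[OF M])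
    then show "g \<in> M" using coset_eq_iff[OF M one_closed gG] gG by simp
  qed
  ultimately have N: "N = {\<one>}" by (rule core)
  have "g = h" if gh: "g \<in> carrier G" "h \<in> carrier G" "?\<phi> g = ?\<phi> h" for g h
  proof -
    have "?\<phi> (inv h \<otimes> g) C = C" if C: "C \<in> lcosets M" for C
    proof -
      have "?\<phi> (inv h \<otimes> g) C = ?\<phi> (inv h) (?\<phi> h C)" using gh C by (simp add: coset_action_comp[OF M])
      then show ?thesis
        using gh(2) C by (simp add: coset_action_comp[OF M, symmetric] coset_action_one[OF M])
    qed
    then have "inv h \<otimes> g \<in> N" using gh by (simp add: N_def)
    then have "inv h \<otimes> g = \<one>" using N by simp
    then show ?thesis using gh by (metis inv_closed inv_equality inv_inv)
  qed
  then have "inj_on ?\<phi> (carrier G)" by (intro inj_onI)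
  then show ?thesis
    using group_action_axioms by (simp add: faithful_action_def faithful_action_axioms_def)
qed

text \<open>Zorn's lemma is applied to the subgroups that contain \<open>H\<close> and avoid the
  single element \<open>a\<close>, a condition that unions of chains inherit. Anything strictly
  above a maximal one contains \<open>a\<close> and hence is the whole group.\<close>

lemma exists_maximal_avoiding:
  assumes H: "subgroup H G" "a \<in> carrier G" "a \<notin> H"
    and gen: "\<And>K. subgroup K G \<Longrightarrow> H \<subseteq> K \<Longrightarrow> a \<in> K \<Longrightarrow> K = carrier G"
  obtains M where "maximal_subgroup M G" "H \<subseteq> M"
proof -
  let ?A = "{K. subgroup K G \<and> H \<subseteq> K \<and> a \<notin> K}"
  have "\<exists>M\<in>?A. \<forall>X\<in>?A. M \<subseteq> X \<longrightarrow> X = M"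
  proof (rule subset_Zorn_nonempty)
    show "?A \<noteq> {}" using H by blast
    fix \<C> assume ne: "\<C> \<noteq> {}" and chain: "subset.chain ?A \<C>"
    have sub: "subgroup K G" "H \<subseteq> K" "a \<notin> K" if "K \<in> \<C>" for K
      using chain that by (auto simp: subset_chain_def)
    have dir: "K \<subseteq> L \<or> L \<subseteq> K" if "K \<in> \<C>" "L \<in> \<C>" for K L
      using chain that by (auto simp: subset_chain_def)
    have "subgroup (\<Union>\<C>) G"
    proof (rule subgroupI)
      show "\<Union>\<C> \<subseteq> carrier G" using sub(1) subgroup.subset by blast
      show "\<Union>\<C> \<noteq> {}" using ne sub(1) subgroup.one_closed by blast
      show "inv g \<in> \<Union>\<C>" if g: "g \<in> \<Union>\<C>" for g
      proof -
        obtain K where K: "K \<in> \<C>" "g \<in> K" using g by (rule UnionE)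
        from subgroup.m_inv_closed[OF sub(1)[OF K(1)] K(2)] K(1) show ?thesis by (rule UnionI[rotated])
      qed
      show "g \<otimes> h \<in> \<Union>\<C>" if gh: "g \<in> \<Union>\<C>" "h \<in> \<Union>\<C>" for g h
      proof -
        obtain K L where KL: "K \<in> \<C>" "L \<in> \<C>" "g \<in> K" "h \<in> L" using gh by blast
        from dir[OF KL(1,2)] show ?thesis
        proof
          assume "K \<subseteq> L"
          then have "g \<otimes> h \<in> L" using subgroup.m_closed[OF sub(1)[OF KL(2)]] KL(3,4) by blast
          then show ?thesis using KL(2) by blast
        next
          assume "L \<subseteq> K"
          then have "g \<otimes> h \<in> K" using subgroup.m_closed[OF sub(1)[OF KL(1)]] KL(3,4) by blast
          then show ?thesis using KL(1) by blast
        qed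
      qed
    qed
    then show "\<Union>\<C> \<in> ?A" using ne sub by blast
  qed
  then obtain M where M_in: "M \<in> ?A" and M_max: "\<forall>X\<in>?A. M \<subseteq> X \<longrightarrow> X = M" by (rule bexE)
  from M_in have M: "subgroup M G" "H \<subseteq> M" "a \<notin> M" by simp_all
  have max: "X = M" if "subgroup X G" "H \<subseteq> X" "a \<notin> X" "M \<subseteq> X" for X
    using M_max that by simp
  have "maximal_subgroup M G"
    unfolding maximal_subgroup_def
  proof (intro conjI allI impI)
    show "M \<noteq> carrier G" using M(3) H(2) by blast
    fix K assume K: "subgroup K G \<and> M \<subseteq> K"
    then have "H \<subseteq> K" using M(2) by blast
    then show "K = M \<or> K = carrier G" using gen[of K] max[of K] K by blast
  qed (rule M(1))
  then show ?thesis using that M(2) by blast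
qed

text \<open>The isomorphism sends \<open>(k, s)\<close> to \<open>t^k a^s\<close>. The relation
  between \<open>a\<close> and \<open>t\<close> makes it a homomorphism, and the conditions on
  natural powers of \<open>t\<close> make it injective.\<close>

lemma infinite_dihedral_iso:
  assumes a: "a \<in> carrier G" "a \<otimes> a = \<one>" and t: "t \<in> carrier G" "a \<otimes> t \<otimes> a = inv t"
    and t_order: "\<And>n::nat. t [^] n = \<one> \<Longrightarrow> n = 0" and t_a: "\<And>n::nat. t [^] n \<noteq> a"
    and gen: "\<And>H. subgroup H G \<Longrightarrow> a \<in> H \<Longrightarrow> t \<in> H \<Longrightarrow> H = carrier G"
  shows "G \<cong> infinite_dihedral"
proof -
  define \<phi> where "\<phi> = (\<lambda>(k::int, s). t [^] k \<otimes> (if s then a else \<one>))"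
  have inv_a: "inv a = a" using a by (intro inv_equality)
  have "(\<lambda>x. a \<otimes> x \<otimes> a) \<in> hom G G"
  proof (rule homI)
    fix x y assume xy: "x \<in> carrier G" "y \<in> carrier G"
    have "a \<otimes> x \<otimes> a \<otimes> (a \<otimes> y \<otimes> a) = a \<otimes> x \<otimes> (a \<otimes> a) \<otimes> y \<otimes> a"
      using xy a(1) by (simp add: m_assoc)
    then show "a \<otimes> (x \<otimes> y) \<otimes> a = a \<otimes> x \<otimes> a \<otimes> (a \<otimes> y \<otimes> a)"
      using xy a by (simp add: m_assoc)
  qed (use a in auto)
  from hom_int_pow[OF this t(1) is_group is_group] have conj: "a \<otimes> t [^] k \<otimes> a = t [^] (- k)" for k :: int
    using t by (simp add: int_pow_inv int_pow_neg)
  have a_t: "a \<otimes> t [^] k = t [^] (- k) \<otimes> a" for k :: int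
  proof -
    have "a \<otimes> t [^] k = a \<otimes> t [^] k \<otimes> (a \<otimes> a)" using a t by simp
    also have "\<dots> = a \<otimes> t [^] k \<otimes> a \<otimes> a" using a t(1) by (simp add: m_assoc)
    finally show ?thesis by (simp only: conj)
  qed
  have "\<phi> \<in> hom infinite_dihedral G"
  proof (rule homI)
    show "\<phi> p \<in> carrier G" for p using a t by (auto simp: \<phi>_def split: prod.splits)
    fix p q :: "int \<times> bool"
    obtain k s l u where pq: "p = (k, s)" "q = (l, u)" by (cases p; cases q)
    show "\<phi> (p \<otimes>\<^bsub>infinite_dihedral\<^esub> q) = \<phi> p \<otimes> \<phi> q"
    proof (cases s)
      case True
      let ?u = "if u then a else \<one>"
      have "\<phi> p \<otimes> \<phi> q = t [^] k \<otimes> (a \<otimes> t [^] l) \<otimes> ?u"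
        using True a t by (simp add: pq \<phi>_def m_assoc)
      also have "\<dots> = t [^] k \<otimes> t [^] (- l) \<otimes> (a \<otimes> ?u)"
        unfolding a_t using a t by (simp add: m_assoc)
      also have "\<dots> = t [^] (k - l) \<otimes> (a \<otimes> ?u)"
        using t by (simp add: int_pow_mult[symmetric])
      finally show ?thesis using True a by (simp add: pq \<phi>_def infinite_dihedral_def)
    next
      case False
      then show ?thesis
        using a t by (simp add: pq \<phi>_def infinite_dihedral_def int_pow_mult m_assoc)
    qed
  qed
  then interpret \<phi>: group_hom infinite_dihedral G \<phi>
    by (simp add: group_hom_def group_hom_axioms_def group_infinite_dihedral)
  have "k = 0 \<and> \<not> s" if "\<phi> (k, s) = \<one>" for k s
  proof -
    have one: "t [^] k \<otimes> (if s then a else \<one>) = \<one>" using that by (simp add: \<phi>_def)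
    \<comment> \<open>Inverting handles negative exponents, as \<open>a\<close> and the identity are
      their own inverses.\<close>
    define n where "n = nat \<bar>k\<bar>"
    have tk: "t [^] k = (if s then a else \<one>)"
      using one a t inv_a by (cases s) (auto, metis inv_equality inv_inv int_pow_closed)
    have "t [^] n = (if s then a else \<one>)"
    proof (cases "k \<ge> 0")
      case True
      then show ?thesis using tk by (simp add: n_def flip: int_pow_int)
    next
      case False
      then have "t [^] n = inv (t [^] k)" using t by (simp add: n_def int_pow_neg flip: int_pow_int)
      then show ?thesis using tk inv_a by simp
    qed
    then show ?thesis using t_order[of n] t_a[of n] by (cases s) (auto simp: n_def)
  qed
  moreover have "\<phi> ` carrier infinite_dihedral = carrier G"
  proof (rule gen[OF \<phi>.img_is_subgroup])
    have "\<phi> (0, True) = a" "\<phi> (1, False) = t" using a t by (simp_all add: \<phi>_def)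
    moreover have "\<phi> p \<in> \<phi> ` carrier infinite_dihedral" for p
      by (simp add: infinite_dihedral_def)
    ultimately show "a \<in> \<phi> ` carrier infinite_dihedral" "t \<in> \<phi> ` carrier infinite_dihedral"
      by metis+
  qed
  ultimately have "\<phi> \<in> iso infinite_dihedral G"
    unfolding \<phi>.iso_iff by (auto simp: infinite_dihedral_def)
  then have "infinite_dihedral \<cong> G" by (auto simp: is_iso_def)
  then show ?thesis by (rule group.iso_sym[OF group_infinite_dihedral])
qed

end

section \<open>Maximal subgroups of infinite index\<close>

context sunic
begin

lemma subgroup_eq_carrier:
  assumes "subgroup H (sunic_group f)" "swp \<in> H" "\<And>x. x \<in> B \<Longrightarrow> \<beta> x \<in> H"
  shows "H = carrier (sunic_group f)"
proof -
  note H = subgroup.m_closed[OF assms(1), unfolded mult_sunic]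
  have "g \<in> H" if "g \<in> G" for g
    using that
  proof (induction rule: sunic_elems.induct)
    case id
    show ?case using subgroup.one_closed[OF assms(1)] unfolding one_sunic .
  next
    case (swap g)
    show ?case by (rule H[OF assms(2) swap(2)])
  next
    case (act x g)
    show ?case by (rule H[OF assms(3)[OF act(1)] act(3)])
  qed
  then show ?thesis using subgroup.subset[OF assms(1)] by auto
qed

text \<open>On an odd index \<open>b\<close> adds 1 and then \<open>a\<close> adds 1, so
  \<open>a b\<close> moves odd indices up by 2. Index 0 is fixed by \<open>b\<close> and sent to 1
  by \<open>a\<close>.\<close>

lemma translation_gray:
  assumes "\<omega> b = 1" "\<rho> b = b"
  shows "((swp \<circ> \<beta> b) ^^ Suc k) (gray n 0) = gray n (2 * k + 1)"
    and "((swp \<circ> \<beta> b) ^^ k) (gray n 1) = gray n (2 * k + 1)"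
proof -
  have step: "swp (\<beta> b (gray n i)) = gray n (i + 2)" if "odd i" for i
    using that by (cases "i = 0") (simp_all add: act_B_fixed_gray[OF assms] swap_first_gray gray_reflect_def)
  have zero: "swp (\<beta> b (gray n 0)) = gray n 1"
    by (simp add: act_B_fixed_gray[OF assms] swap_first_gray gray_reflect_def)
  show 2: "((swp \<circ> \<beta> b) ^^ k) (gray n 1) = gray n (2 * k + 1)" for k
    by (induction k) (simp_all add: step)
  show "((swp \<circ> \<beta> b) ^^ Suc k) (gray n 0) = gray n (2 * k + 1)"
    using 2[of k] zero by (simp add: funpow_swap1)
qed

text \<open>\<open>B\<close> has order 2 and its generator is fixed by \<open>\<rho>\<close>, so the
  group is generated by two involutions. That \<open>a b\<close> has infinite order is read off from
  its displacement of the half-line.\<close>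

lemma degree_one_dihedral:
  assumes "degree f = 1"
  shows "sunic_group f \<cong> infinite_dihedral"
proof -
  let ?b = "sunic_b 0" and ?D = "sunic_group f"
  interpret D: group ?D by (rule group_sunic_group)
  have b: "?b \<in> B" "\<omega> ?b = 1" "\<rho> ?b = ?b"
    using assms coeff0
    by (auto simp: sunic_B_def sunic_b_def omega_apply rho_apply fun_eq_iff bit_not_zero_iff)
  let ?t = "swp \<circ> \<beta> ?b"
  note gray = translation_gray[OF b(2,3)]
  have t_in: "?t \<in> G" by (intro sunic_elems_comp swap_first_in act_B_in b)
  have inv_t: "invf ?t = swp \<circ> ?t \<circ> swp"
    by (rule inv_eqI) (rule ext, simp)+
  \<comment> \<open>At level \<open>2 k + 1\<close> the index \<open>2 k + 1\<close> is still
    determined by its vertex.\<close>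
  have big: "2 * k + 1 < (2::nat) ^ (2 * k + 1)" for k by (rule less_exp)
  show ?thesis
  proof (rule D.infinite_dihedral_iso)
    show "swp \<in> carrier ?D" by (simp add: swap_first_in)
    show "swp \<otimes>\<^bsub>?D\<^esub> swp = \<one>\<^bsub>?D\<^esub>" by (simp only: mult_sunic one_sunic swap_first_swap_first)
    show "?t \<in> carrier ?D" using t_in by (simp only: carrier_sunic)
    show "swp \<otimes>\<^bsub>?D\<^esub> ?t \<otimes>\<^bsub>?D\<^esub> swp = inv\<^bsub>?D\<^esub> ?t"
      by (simp only: mult_sunic m_inv_sunic[OF t_in] inv_t)
    show "n = 0" if one: "?t [^]\<^bsub>?D\<^esub> n = \<one>\<^bsub>?D\<^esub>" for n :: nat
    proof (rule ccontr)
      assume "n \<noteq> 0"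
      then obtain k where n: "n = Suc k" by (cases n) auto
      have "?t ^^ Suc k = id" using one by (simp only: n pow_sunic one_sunic)
      then have "gray (2 * k + 1) (2 * k + 1) = gray (2 * k + 1) 0"
        using gray(1)[of k "2 * k + 1"] by (simp only: id_apply)
      from gray_inj[OF this big] show False by simp
    qed
    show "?t [^]\<^bsub>?D\<^esub> n \<noteq> swp" for n :: nat
    proof
      assume "?t [^]\<^bsub>?D\<^esub> n = swp"
      then have "?t ^^ n = swp" by (simp only: pow_sunic)
      \<comment> \<open>Index 1 separates the two: a power of \<open>a b\<close> sends it to an odd
        index, \<open>a\<close> sends it to 0.\<close>
      then have "gray (2 * n + 1) (2 * n + 1) = swp (gray (2 * n + 1) 1)"
        using gray(2)[of n "2 * n + 1"] by (simp only:)
      also have "\<dots> = gray (2 * n + 1) 0" by (simp add: swap_first_gray del: gray.simps)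
      finally show False using gray_inj[OF _ big] by fastforce
    qed
    show "H = carrier ?D" if H: "subgroup H ?D" "swp \<in> H" "?t \<in> H" for H
    proof (rule subgroup_eq_carrier[OF H(1,2)])
      fix x assume x: "x \<in> B"
      have "swp \<circ> ?t \<in> H" using subgroup.m_closed[OF H] unfolding mult_sunic .
      then have b_in: "\<beta> ?b \<in> H" by (simp only: comp_assoc[symmetric] swap_first_swap_first id_comp)
      have zero: "x i = 0" if "i \<noteq> 0" for i using x that assms by (simp add: sunic_B_def)
      have "x = ?b \<or> x = (\<lambda>_. 0)"
        using bit_cases[of "x 0"]
      proof
        assume "x 0 = 0"
        then have "x i = 0" for i using zero[of i] by (cases "i = 0") simp_all
        then show ?thesis by blast
      next
        assume "x 0 = 1"
        then have "x i = ?b i" for i using zero[of i] by (cases "i = 0") (simp_all add: sunic_b_def)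
        then show ?thesis by blast
      qed
      then show "\<beta> x \<in> H"
        using b_in subgroup.one_closed[OF H(1)] act_B_zero unfolding one_sunic by metis
    qed
  qed
qed

end

lemma subgroup_sunicD:
  assumes "subgroup M (sunic_group f)"
  shows "g \<in> M \<Longrightarrow> g \<in> sunic_elems f" "id \<in> M"
    and "g \<in> M \<Longrightarrow> h \<in> M \<Longrightarrow> g \<circ> h \<in> M"
    and "g \<in> M \<Longrightarrow> invf g \<in> M"
proof -
  show in_G: "g \<in> sunic_elems f" if "g \<in> M" for g
    using subgroup.subset[OF assms] that unfolding carrier_sunic by blast
  show "id \<in> M" using subgroup.one_closed[OF assms] unfolding one_sunic .
  show "g \<in> M \<Longrightarrow> h \<in> M \<Longrightarrow> g \<circ> h \<in> M" using subgroup.m_closed[OF assms] unfolding mult_sunic .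
  show "invf g \<in> M" if "g \<in> M"
    using subgroup.m_inv_closed[OF assms that] unfolding m_inv_sunic[OF in_G[OF that]] .
qed

text \<open>The orbit of index 0 under \<open>a b a b a\<close> and \<open>b\<close>: five steps
  along the half-line exchange \<open>6 k\<close> and \<open>6 k + 5\<close>, and \<open>b\<close>
  joins \<open>6 k + 5\<close> to \<open>6 k + 6\<close>. The modulus is twice the exponent
  3.\<close>

definition orbit_index :: "nat \<Rightarrow> bool" where
  "orbit_index j \<longleftrightarrow> j mod 6 = 0 \<or> j mod 6 = 5"

lemma orbit_indexE:
  assumes "orbit_index j"
  obtains k where "j = 6 * k" | k where "j = 6 * k + 5"
  using assms mult_div_mod_eq[of 6 j] unfolding orbit_index_def by (metis add_0_right)

lemma orbit_index_simps [simp]: "orbit_index (6 * k)" "orbit_index (6 * k + 5)"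
  by (simp_all add: orbit_index_def)

lemma orbit_index_reflect:
  assumes "orbit_index j"
  shows "orbit_index (gray_reflect j)" "gray_reflect j \<le> j + 1"
proof -
  from assms have "orbit_index (gray_reflect j) \<and> gray_reflect j \<le> j + 1"
  proof (cases rule: orbit_indexE)
    case (1 k)
    show ?thesis
    proof (cases k)
      case 0
      then show ?thesis using 1 orbit_index_simps(1)[of 0] by (simp add: gray_reflect_def)
    next
      case (Suc i)
      then have "gray_reflect j = 6 * i + 5" using 1 by (simp add: gray_reflect_def)
      then show ?thesis using 1 Suc by simp
    qed
  next
    case (2 k)
    then have "gray_reflect j = 6 * (k + 1)" by (simp add: gray_reflect_def)
    then show ?thesis using 2 orbit_index_simps(1)[of "k + 1"] by simp
  qed
  then show "orbit_index (gray_reflect j)" "gray_reflect j \<le> j + 1" by blast+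
qed

text \<open>The subgroup generated by \<open>a b a b a\<close> and \<open>B\<close> preserves the indices congruent to 0 or 5 modulo
  6, so it does not contain \<open>a\<close>, which moves index 0 to index 1. Since vertices of level \<open>n\<close> only
  determine their index modulo \<open>2\<^sup>n\<close>, the displacement of the index has to be bounded uniformly in
  the level.\<close>

definition preserves_orbit :: "(vertex \<Rightarrow> vertex) \<Rightarrow> bool" where
  "preserves_orbit g \<longleftrightarrow> (\<exists>C. \<forall>n j. orbit_index j \<longrightarrow>
    (\<exists>j'. orbit_index j' \<and> j' \<le> j + C \<and> g (gray n j) = gray n j'))"

lemma preserves_orbit_id: "preserves_orbit id"
  unfolding preserves_orbit_def by (intro exI[of _ 0]) auto

lemma preserves_orbit_comp:
  assumes "preserves_orbit g" "preserves_orbit h"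
  shows "preserves_orbit (g \<circ> h)"
proof -
  obtain C where C: "\<And>n j. orbit_index j \<Longrightarrow> \<exists>j'. orbit_index j' \<and> j' \<le> j + C \<and> g (gray n j) = gray n j'"
    using assms(1) unfolding preserves_orbit_def by blast
  obtain D where D: "\<And>n j. orbit_index j \<Longrightarrow> \<exists>j'. orbit_index j' \<and> j' \<le> j + D \<and> h (gray n j) = gray n j'"
    using assms(2) unfolding preserves_orbit_def by blast
  have "\<exists>j'. orbit_index j' \<and> j' \<le> j + (C + D) \<and> (g \<circ> h) (gray n j) = gray n j'"
    if j: "orbit_index j" for n j
  proof -
    obtain i where i: "orbit_index i" "i \<le> j + D" "h (gray n j) = gray n i" using D[OF j] by blast
    obtain k where k: "orbit_index k" "k \<le> i + C" "g (gray n i) = gray n k" using C[OF i(1)] by blast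
    show ?thesis using i k by (intro exI[of _ k]) simp
  qed
  then show ?thesis unfolding preserves_orbit_def by blast
qed

lemma preserves_orbit_act_B: "preserves_orbit (act_B f x)"
proof -
  have "\<exists>j'. orbit_index j' \<and> j' \<le> j + 1 \<and> act_B f x (gray n j) = gray n j'"
    if "orbit_index j" for n j
    using that orbit_index_reflect[OF that] act_B_gray[of f x n j] le_add1[of j 1] by blast
  then show ?thesis unfolding preserves_orbit_def by blast
qed

context sunic
begin

lemma proper_subgroup:
  assumes b: "b \<in> B" "\<omega> b = 1" "\<rho> b = b"
  shows "swp \<notin> generate (sunic_group f) (insert (swp \<circ> \<beta> b \<circ> swp \<circ> \<beta> b \<circ> swp) (\<beta> ` B))"
    (is "_ \<notin> generate _ ?S")
proof
  let ?c = "swp \<circ> \<beta> b \<circ> swp \<circ> \<beta> b \<circ> swp"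
  note fixed = act_B_fixed_gray[OF b(2,3)]
  have c: "\<exists>j'. orbit_index j' \<and> j' \<le> j + 5 \<and> ?c (gray n j) = gray n j'" if "orbit_index j" for n j
  proof -
    from that show ?thesis
    proof (cases rule: orbit_indexE)
      case (1 k)
      have five: "6 * k + 5 = Suc (Suc (Suc (Suc (Suc (6 * k)))))" by simp
      have "?c (gray n j) = gray n (6 * k + 5)"
        unfolding 1 five by (simp add: swap_first_gray fixed gray_reflect_def)
      then show ?thesis using 1 by (intro exI[of _ "6 * k + 5"]) simp
    next
      case (2 k)
      have "?c (gray n j) = gray n (6 * k)"
        unfolding 2 by (simp add: swap_first_gray fixed gray_reflect_def)
      then show ?thesis using 2 by (intro exI[of _ "6 * k"]) simp
    qed
  qed
  have S: "preserves_orbit s \<and> s \<in> G \<and> invf s = s" if "s \<in> ?S" for s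
    using that
  proof
    assume s: "s = ?c"
    have "?c \<circ> ?c = id" by (rule ext) simp
    then have "invf ?c = ?c" by (rule involution_inv)
    moreover have "?c \<in> G" by (intro sunic_elems_comp swap_first_in act_B_in b)
    moreover have "preserves_orbit ?c" using c unfolding preserves_orbit_def by blast
    ultimately show ?thesis unfolding s by blast
  next
    assume "s \<in> \<beta> ` B"
    then show ?thesis using preserves_orbit_act_B act_B_in inv_act_B by blast
  qed
  have "preserves_orbit g" if "g \<in> generate (sunic_group f) ?S" for g
    using that
  proof (induction rule: generate.induct)
    case one
    show ?case unfolding one_sunic by (rule preserves_orbit_id)
  next
    case (incl h)
    then show ?case using S by blast
  next
    case (inv h)
    then show ?case using S[OF inv] m_inv_sunic[of h f] by (simp only:)
  next
    case (eng g h)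
    then show ?case unfolding mult_sunic by (intro preserves_orbit_comp)
  qed
  moreover assume "swp \<in> generate (sunic_group f) ?S"
  ultimately have "preserves_orbit swp" by blast
  then obtain C where C: "\<And>n. \<exists>j. orbit_index j \<and> j \<le> C \<and> swp (gray n 0) = gray n j"
    unfolding preserves_orbit_def by (metis add_0 mod_0 orbit_index_def)
  \<comment> \<open>At level \<open>C + 1\<close> the indices up to \<open>C\<close>, and the index
    1, are below \<open>2^(C + 1)\<close> and so are told apart by their vertices; the image of
    index 0 under \<open>a\<close> can only be 1.\<close>
  from C[of "C + 1"] obtain j where j: "orbit_index j" "j \<le> C" "swp (gray (C + 1) 0) = gray (C + 1) j"
    by blast
  have exp: "C + 1 < 2 ^ (C + 1)" by (rule less_exp)
  have "j < 2 ^ (C + 1)" "1 < (2::nat) ^ (C + 1)" using exp j(2) by linarith+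
  moreover have "gray (C + 1) 1 = gray (C + 1) j" using j(3) unfolding swap_first_gray by simp
  ultimately have "1 = j" using gray_inj by blast
  then show False using j(1) by (simp add: orbit_index_def)
qed

lemma exists_maximal:
  assumes b: "b \<in> B" "\<omega> b = 1" "\<rho> b = b"
  obtains M where "maximal_subgroup M (sunic_group f)" "swp \<circ> \<beta> b \<circ> swp \<circ> \<beta> b \<circ> swp \<in> M" "\<beta> ` B \<subseteq> M"
proof -
  interpret \<Gamma>: group "sunic_group f" by (rule group_sunic_group)
  let ?c = "swp \<circ> \<beta> b \<circ> swp \<circ> \<beta> b \<circ> swp"
  let ?S = "insert ?c (\<beta> ` B)"
  let ?H = "generate (sunic_group f) ?S"
  have "?c \<in> G" by (intro sunic_elems_comp swap_first_in act_B_in b)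
  then have "?S \<subseteq> carrier (sunic_group f)" using act_B_in by auto
  then have H: "subgroup ?H (sunic_group f)" by (rule \<Gamma>.generate_is_subgroup)
  have S: "?S \<subseteq> ?H" by (intro subsetI generate.incl)
  have a_in: "swp \<in> carrier (sunic_group f)" using swap_first_in by simp
  have gen: "K = carrier (sunic_group f)" if "subgroup K (sunic_group f)" "?H \<subseteq> K" "swp \<in> K" for K
    by (rule subgroup_eq_carrier[OF that(1,3)], rule subsetD[OF subset_trans[OF S that(2)]]) simp
  obtain M where "maximal_subgroup M (sunic_group f)" "?H \<subseteq> M"
    using \<Gamma>.exists_maximal_avoiding[OF H a_in proper_subgroup[OF b] gen] .
  then show ?thesis using that subset_trans[OF S] by simp
qed

end

text \<open>Even exponents work because 4 is 1 modulo 3. The bound on \<open>i\<close> makes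
  \<open>2^i\<close> a multiple of the given \<open>2^k\<close>.\<close>

lemma power2_mod_3: "\<exists>i\<ge>k. \<exists>u. (2::nat) ^ i = 3 * u + 1"
proof -
  have "(4::nat) ^ k mod 3 = 1" by (induction k) (simp_all add: mod_mult_eq[symmetric])
  then have "(2::nat) ^ (2 * k) mod 3 = 1" by (simp add: power_mult)
  then have "(2::nat) ^ (2 * k) = 3 * ((2::nat) ^ (2 * k) div 3) + 1"
    using mult_div_mod_eq[of 3 "(2::nat) ^ (2 * k)"] by simp
  moreover have "k \<le> 2 * k" by simp
  ultimately show ?thesis by blast
qed

section \<open>Cores of maximal subgroups\<close>

context sunic2
begin

lemma maximal_core_free:
  assumes b: "b \<in> B" "\<omega> b = 1" "\<rho> b = b"
    and M: "maximal_subgroup M (sunic_group f)" "swp \<circ> \<beta> b \<circ> swp \<circ> \<beta> b \<circ> swp \<in> M" "\<beta> ` B \<subseteq> M"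
    and N: "N \<lhd> sunic_group f" "N \<subseteq> M"
  shows "N = {id}"
proof (rule ccontr)
  assume "N \<noteq> {id}"
  then obtain g where g: "g \<in> N" "g \<noteq> id" using normal_sunicD(2)[OF N(1)] by blast
  have sub: "subgroup M (sunic_group f)" and ne: "M \<noteq> carrier (sunic_group f)"
    using M(1) by (simp_all add: maximal_subgroup_def)
  note M_rules = subgroup_sunicD[OF sub]
  have b_in: "\<beta> b \<in> M" using M(3) b(1) by blast
  let ?t = "swp \<circ> \<beta> b"
  have pow: "h ^^ n \<in> M" if "h \<in> M" for h n
    using that by (induction n) (simp_all only: funpow.simps M_rules)
  have "?t ^^ 3 = swp \<circ> \<beta> b \<circ> swp \<circ> \<beta> b \<circ> swp \<circ> \<beta> b"
    by (simp only: numeral_3_eq_3 funpow.simps comp_id comp_assoc)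
  then have t3: "?t ^^ 3 \<in> M" using M_rules(3)[OF M(2) b_in] by (simp only: comp_assoc)
  obtain k where "?t ^^ (2 ^ k) \<in> N" using translation_power_in_normal[OF N(1) g b] by blast
  then have tk: "?t ^^ (2 ^ k) \<in> M" using N(2) by blast
  obtain i u where i: "i \<ge> k" "(2::nat) ^ i = 3 * u + 1" using power2_mod_3 by blast
  have "(2::nat) ^ i = 2 ^ k * 2 ^ (i - k)" using i(1) by (simp flip: power_add)
  then have "?t ^^ (2 ^ i) = (?t ^^ (2 ^ k)) ^^ (2 ^ (i - k))" by (simp only: funpow_mult)
  then have ti: "?t ^^ (2 ^ i) \<in> M" using pow[OF tk] by (simp only:)
  let ?h = "?t ^^ (3 * u)"
  have "?h = (?t ^^ 3) ^^ u" by (simp only: funpow_mult)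
  then have h: "?h \<in> M" using pow[OF t3] by (simp only:)
  have "?t ^^ (2 ^ i) = ?h \<circ> ?t"
    unfolding i(2) funpow_add by (simp only: One_nat_def funpow.simps comp_id)
  \<comment> \<open>Since \<open>2^i - 3 u = 1\<close>, the element \<open>a b\<close> is a quotient
    of two elements of \<open>M\<close>.\<close>
  then have "invf ?h \<circ> ?t ^^ (2 ^ i) = ?t"
    by (simp only:) (rule ext, simp only: comp_apply[of "invf ?h"] comp_apply[of ?h] inv_apply(1)[OF M_rules(1)[OF h]])
  then have "?t \<in> M" using M_rules(3)[OF M_rules(4)[OF h] ti] by (simp only:)
  then have "?t \<circ> \<beta> b \<in> M" using b_in by (rule M_rules(3))
  then have "swp \<in> M" by (simp only: comp_assoc act_B_act_B comp_id)
  then have "M = carrier (sunic_group f)"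
    using subgroup_eq_carrier[OF sub] M(3) by blast
  with ne show False by contradiction
qed

text \<open>For a nontrivial \<open>N\<close> inside \<open>M\<close>, the finite set
  \<open>F\<close> that covers the group modulo \<open>N\<close> also represents all cosets of
  \<open>M\<close>: with \<open>h = e p\<close> and \<open>p\<close> in \<open>M\<close>, the coset
  of \<open>h\<close> is \<open>e M\<close>.\<close>

lemma infinite_index_core_free:
  assumes M: "subgroup M (sunic_group f)" "infinite_index M (sunic_group f)"
    and N: "N \<lhd> sunic_group f" "N \<subseteq> M"
  shows "N = {id}"
proof (rule ccontr)
  assume "N \<noteq> {id}"
  then obtain g where g: "g \<in> N" "g \<noteq> id" using normal_sunicD(2)[OF N(1)] by blast
  obtain F where F: "finite F \<and> (\<forall>h\<in>G. \<exists>e\<in>F. \<exists>p\<in>N. h = e \<circ> p)"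
    using normal_cover[OF N(1) g] by (rule exE)
  note M_rules = subgroup_sunicD[OF M(1)]
  \<comment> \<open>Elements of \<open>F\<close> may lie outside the group, so \<open>e M\<close> is
    written as a plain set of functions.\<close>
  let ?c = "\<lambda>e. {e \<circ> x | x. x \<in> M}"
  have coset: "C \<in> ?c ` F" if C: "C \<in> lcosets\<^bsub>sunic_group f\<^esub> M" for C
  proof -
    obtain h where h: "h \<in> G" "C = h <#\<^bsub>sunic_group f\<^esub> M"
      using group.lcosetsE[OF group_sunic_group C] unfolding carrier_sunic .
    obtain e p where e: "e \<in> F" "p \<in> N" "h = e \<circ> p"
      using bspec[OF F[THEN conjunct2] h(1)] by (elim bexE)
    have p: "p \<in> M" using e(2) N(2) by blast
    have "C = {h \<circ> x | x. x \<in> M}" unfolding h(2) l_coset_def mult_sunic by blast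
    also have "\<dots> = {e \<circ> x | x. x \<in> M}"
    proof (rule subset_antisym; rule subsetI)
      fix w assume "w \<in> {h \<circ> x | x. x \<in> M}"
      then obtain x where "x \<in> M" "w = h \<circ> x" by blast
      then have "w = e \<circ> (p \<circ> x)" "p \<circ> x \<in> M"
        using e(3) p M_rules(3) by (simp_all only: comp_assoc)
      then show "w \<in> {e \<circ> x | x. x \<in> M}" by blast
    next
      fix w assume "w \<in> {e \<circ> x | x. x \<in> M}"
      then obtain x where x: "x \<in> M" "w = e \<circ> x" by blast
      have "w = h \<circ> (invf p \<circ> x)"
        unfolding x(2) e(3) by (rule ext) (simp add: inv_apply[OF M_rules(1)[OF p]])
      moreover have "invf p \<circ> x \<in> M" using M_rules(3)[OF M_rules(4)[OF p] x(1)] .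
      ultimately show "w \<in> {h \<circ> x | x. x \<in> M}" by blast
    qed
    finally show ?thesis using e(1) by blast
  qed
  have "finite (?c ` F)" using F[THEN conjunct1] by (rule finite_imageI)
  then have "finite (lcosets\<^bsub>sunic_group f\<^esub> M)"
    by (rule finite_subset[rotated]) (rule subsetI, rule coset)
  then show False using M(2) by (simp add: infinite_index_def)
qed

end

theorem corollary1p4:
  fixes f :: "bit poly" and G :: "(vertex \<Rightarrow> vertex) monoid"
  assumes "lead_coeff f = 1" and "degree f \<ge> 1" and "coeff f 0 \<noteq> 0"
    and "G = sunic_group f"
    and "\<not> torsion_group G"
    and "\<not> G \<cong> infinite_dihedral"
  shows "primitive_group G \<and>
    (\<forall>M. maximal_subgroup M G \<and> infinite_index M G \<longrightarrow>
       primitive_action G (lcosets\<^bsub>G\<^esub> M) (coset_action G M) \<and>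
       faithful_action G (lcosets\<^bsub>G\<^esub> M) (coset_action G M))"
proof -
  interpret S: sunic f by unfold_locales (fact assms)+
  have "degree f \<noteq> 1" using S.degree_one_dihedral assms by blast
  then interpret S: sunic2 f by unfold_locales (use assms(2) in simp)
  interpret group G unfolding assms(4) by (rule group_sunic_group)
  have sub: "subgroup M G" if "maximal_subgroup M G" for M
    using that by (simp add: maximal_subgroup_def)
  obtain b where b: "b \<in> sunic_B f" "sunic_omega f b = 1" "sunic_rho f b = b"
    using S.nontorsion_fixed_point assms by blast
  obtain M where M: "maximal_subgroup M G"
    "swap_first \<circ> act_B f b \<circ> swap_first \<circ> act_B f b \<circ> swap_first \<in> M" "act_B f ` sunic_B f \<subseteq> M"
    using S.exists_maximal[OF b] unfolding assms(4) .
  have "faithful_action G (lcosets\<^bsub>G\<^esub> M) (coset_action G M)"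
    using S.maximal_core_free[OF b M[unfolded assms(4)]]
    by (intro faithful_coset_action[OF sub[OF M(1)]]) (simp only: one_sunic assms(4))
  then have primitive: "primitive_group G"
    unfolding primitive_group_def
    by (intro exI[of _ "lcosets\<^bsub>G\<^esub> M"] exI[of _ "coset_action G M"] conjI primitive_coset_action[OF M(1)])
  have faithful: "faithful_action G (lcosets\<^bsub>G\<^esub> M) (coset_action G M)"
    if "maximal_subgroup M G" "infinite_index M G" for M
    using S.infinite_index_core_free[OF sub[OF that(1), unfolded assms(4)] that(2)[unfolded assms(4)]]
    by (intro faithful_coset_action[OF sub[OF that(1)]]) (simp only: one_sunic assms(4))
  show ?thesis
  proof (intro conjI allI impI)
    show "primitive_group G" by (rule primitive)
    fix M assume M: "maximal_subgroup M G \<and> infinite_index M G"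
    show "primitive_action G (lcosets\<^bsub>G\<^esub> M) (coset_action G M)"
      by (rule primitive_coset_action[OF M[THEN conjunct1]])
    show "faithful_action G (lcosets\<^bsub>G\<^esub> M) (coset_action G M)"
      by (rule faithful[OF M[THEN conjunct1] M[THEN conjunct2]])
  qed
qed

end
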